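(* Let $n>k\ge 2$ and let $\Gamma$ be a 2-edge connected simple graph with $n$ vertices. If $\Gamma$ is a cycle, then its defect $k$ group is $Z_{n-k}$. If $\Gamma$ is not a cycle, then its defect $k$ group is the symmetric group $S_{n-k}$.
   Context: For a finite simple undirected graph $\Gamma=(V,E)$, the flow semigroup $S_\Gamma$ is the semigroup of transformations of $V$ (acting on the right) generated by the elementary collapsings $e_{uv}$ and $e_{vu}$ for all edges $uv\in E$, where $e_{uv}$ maps $u$ to $v$ and fixes every other vertex. For $1\le k\le |V|-1$ and $V_k\subseteq V$ with $|V_k|=k$, the defect $k$ group $G_{k,V_k}$ is the permutation group on $V\setminus V_k$ generated by the restrictions $s|_{V\setminus V_k}$ of all $s\in S_\Gamma$ with $(V\setminus V_k)s=V\setminus V_k$ and $V_k s\subseteq V\setminus V_k$; for connected $\Gamma$ it is independent of $V_k$ up to permutation isomorphism and is called the defect $k$ group of $\Gamma$. A graph is 2-edge connected if it is connected and removing any single edge does not disconnect it. *)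

theory Defs
  imports
    "Graph_Theory.Graph_Theory"
    "HOL-Algebra.Bij"
    "HOL-Algebra.Generated_Groups"
    "HOL-Algebra.Elementary_Groups"
    "HOL-Algebra.Sym_Groups"
begin

text \<open>
  A finite simple undirected graph is a \<^locale>\<open>pair_graph\<close>: an edge \<open>uv\<close> is the pair of
  arcs \<open>(u, v)\<close> and \<open>(v, u)\<close>, so removing an edge means removing both of them.
\<close>

definition remove_edge :: "'a pair_pre_digraph \<Rightarrow> 'a \<Rightarrow> 'a \<Rightarrow> 'a pair_pre_digraph" where
  "remove_edge G u v = G\<lparr>parcs := parcs G - {(u, v), (v, u)}\<rparr>"

definition two_edge_connected :: "'a pair_pre_digraph \<Rightarrow> bool" where
  "two_edge_connected G \<longleftrightarrow>
     Digraph_Component.connected (with_proj G) \<and>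
     (\<forall>(u, v) \<in> parcs G. Digraph_Component.connected (with_proj (remove_edge G u v)))"

definition is_cycle_graph :: "'a pair_pre_digraph \<Rightarrow> bool" where
  "is_cycle_graph G \<longleftrightarrow>
     (\<exists>n c. 3 \<le> n \<and> bij_betw c {..<n} (pverts G) \<and>
        parcs G = (\<Union>i<n. {(c i, c (Suc i mod n)), (c (Suc i mod n), c i)}))"

text \<open>
  A transformation of the vertex set is represented by a function on the whole type that fixes
  all non-vertices.
\<close>

definition collapsing :: "'a \<Rightarrow> 'a \<Rightarrow> ('a \<Rightarrow> 'a)" where
  "collapsing u v = id(u := v)"

text \<open>
  Transformations act on the right in the source, so the product \<open>st\<close> is \<open>t \<circ> s\<close>. As
  \<open>s\<close> and \<open>t\<close> both range over the whole semigroup, the order has no influence on the set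
  that is generated.
\<close>

inductive_set flow_semigroup :: "'a pair_pre_digraph \<Rightarrow> ('a \<Rightarrow> 'a) set"
  for G :: "'a pair_pre_digraph" where
  gen: "(u, v) \<in> parcs G \<Longrightarrow> collapsing u v \<in> flow_semigroup G"
| mult: "s \<in> flow_semigroup G \<Longrightarrow> t \<in> flow_semigroup G \<Longrightarrow> t \<circ> s \<in> flow_semigroup G"

definition defect_group :: "'a pair_pre_digraph \<Rightarrow> 'a set \<Rightarrow> ('a \<Rightarrow> 'a) monoid" where
  "defect_group G W =
     (let X = pverts G - W in
      (BijGroup X)\<lparr>carrier := generate (BijGroup X)
         {restrict s X | s. s \<in> flow_semigroup G \<and> s ` X = X \<and> s ` W \<subseteq> X}\<rparr>)"

text \<open>
  Permutation isomorphism of \<open>A\<close> acting on \<open>X\<close> by \<open>\<alpha>\<close> and \<open>B\<close> acting on \<open>Y\<close> by \<open>\<beta>\<close>.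
\<close>

definition perm_isomorphic ::
  "('g, 'm) monoid_scheme \<Rightarrow> 'x set \<Rightarrow> ('g \<Rightarrow> 'x \<Rightarrow> 'x) \<Rightarrow>
   ('h, 'n) monoid_scheme \<Rightarrow> 'y set \<Rightarrow> ('h \<Rightarrow> 'y \<Rightarrow> 'y) \<Rightarrow> bool" where
  "perm_isomorphic A X \<alpha> B Y \<beta> \<longleftrightarrow>
     (\<exists>h \<in> iso A B. \<exists>f. bij_betw f X Y \<and>
        (\<forall>g \<in> carrier A. \<forall>x \<in> X. f (\<alpha> g x) = \<beta> (h g) (f x)))"

text \<open>
  As a permutation group of degree \<open>m\<close>, the cyclic group of order \<open>m\<close> acts on itself by
  translations, and the symmetric group acts naturally on \<open>{1..m}\<close>.
\<close>

definition is_cyclic_perm_group :: "('a \<Rightarrow> 'a) monoid \<Rightarrow> 'a set \<Rightarrow> nat \<Rightarrow> bool" where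
  "is_cyclic_perm_group A X m \<longleftrightarrow>
     perm_isomorphic A X (\<lambda>g. g)
       (integer_mod_group m) (carrier (integer_mod_group m)) (mult (integer_mod_group m))"

definition is_symmetric_perm_group :: "('a \<Rightarrow> 'a) monoid \<Rightarrow> 'a set \<Rightarrow> nat \<Rightarrow> bool" where
  "is_symmetric_perm_group A X m \<longleftrightarrow>
     perm_isomorphic A X (\<lambda>g. g) (sym_group m) {1..m} (\<lambda>p. p)"

end

theory Submission
  imports Defs
begin

text \<open>
  On the vertices outside \<open>W\<close> the flow semigroup acts as sliding tokens with \<open>k\<close> holes.

  If the graph is not a cycle, it suffices to use two of the holes. At a vertex with three neighbours
  two holes suffice to exchange two tokens. Interchangeability of tokens is an equivalence relation
  that is preserved by all moves, so it spreads from this star to larger and larger connected sets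
  \<open>S\<close>: a new vertex \<open>x\<close> next to \<open>s \<in> S\<close> is absorbed either because a path outside \<open>S\<close> leads from
  \<open>x\<close> back to another vertex of \<open>S\<close>, so that a hole can be sent around the ear, or because \<open>s\<close> is the
  centre of a star with two leaves inside and two leaves outside \<open>S\<close>. If neither applies, there is a
  bridge. Hence all transpositions of tokens are realised.

  On a cycle the cyclic order of the tokens is invariant, so only rotations occur, and as there is a
  free vertex the tokens can all advance by one place.
\<close>

section \<open>Sliding tokens\<close>

text \<open>Collapsings along edges are not invertible. The symmetric case therefore replaces the
  collapsing of a vertex into a hole by the transposition of the two contents, which agrees with it
  on all tokens. Moves can then be undone and conjugated, and interchangeability becomes a relation
  between labels that does not depend on the position in which the exchange is carried out. Vertices
  of \<open>W\<close> beyond the two chosen holes carry dummy tokens, which the realised permutation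
  returns to their places. The bound 4 is the size of the first star, and it is what absorbing along
  an ear consumes: the two ends of the ear, a place for the second hole, and a place for a token
  that stays untouched. On a cycle, an invariant cyclic order is awkward to state on residues.
  Unrolled to the integers it is strict monotonicity with a periodicity law, and a rotation is a
  shift of the index.\<close>

text \<open>A position \<open>\<pi>\<close> maps labels to vertices; the labels in \<open>H\<close> are holes, all others are
  tokens. A move exchanges a hole with the content of an adjacent vertex, which may itself be a
  hole.\<close>

inductive slide :: "('a \<times> 'a) set \<Rightarrow> 'a set \<Rightarrow> ('a \<Rightarrow> 'a) \<Rightarrow> ('a \<Rightarrow> 'a) \<Rightarrow> bool"
  for R :: "('a \<times> 'a) set" and H :: "'a set" and \<pi> :: "'a \<Rightarrow> 'a" where
  refl: "slide R H \<pi> \<pi>"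
| step: "slide R H \<pi> \<rho> \<Longrightarrow> h \<in> H \<Longrightarrow> (\<rho> h, v) \<in> R \<Longrightarrow>
    slide R H \<pi> (Transposition.transpose (\<rho> h) v \<circ> \<rho>)"

lemma slide_move:
  assumes "slide R H \<pi> \<rho>" "h \<in> H" "\<rho> h = u" "(u, v) \<in> R"
  shows "slide R H \<pi> (Transposition.transpose u v \<circ> \<rho>)"
  using slide.step[OF assms(1,2)] assms(3,4) by blast

lemma slide_trans:
  assumes "slide R H \<pi> \<rho>" "slide R H \<rho> \<sigma>"
  shows "slide R H \<pi> \<sigma>"
  using assms(2)
proof induction
  case (step \<rho>' h v)
  then show ?case using slide_move[OF step.IH step.hyps(2)] by blast
qed (rule assms)

lemma slide_mono:
  assumes "slide R H \<pi> \<rho>" "R \<subseteq> R'"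
  shows "slide R' H \<pi> \<rho>"
  using assms(1)
proof induction
  case (step \<rho> h v)
  then show ?case using assms(2) slide_move[OF step.IH step.hyps(2)] by blast
qed (rule slide.refl)

lemma slide_sym:
  assumes "slide R H \<pi> \<rho>" "sym R"
  shows "slide R H \<rho> \<pi>"
  using assms(1)
proof induction
  case (step \<rho> h v)
  let ?\<sigma> = "Transposition.transpose (\<rho> h) v \<circ> \<rho>"
  have "slide R H ?\<sigma> (Transposition.transpose v (\<rho> h) \<circ> ?\<sigma>)"
    using step.hyps(2) symD[OF assms(2) step.hyps(3)]
    by (intro slide_move[OF slide.refl, where h = h]) simp_all
  moreover have "Transposition.transpose v (\<rho> h) \<circ> ?\<sigma> = \<rho>"
    by (rule ext) (simp add: transpose_commute[of v "\<rho> h"])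
  ultimately show ?case
    using step.IH by (simp only: slide_trans)
qed (rule slide.refl)

text \<open>Moves act on vertices, so they commute with a renaming of the labels, provided that
  holes are renamed to holes.\<close>

lemma slide_comp:
  assumes "slide R H \<pi> \<rho>" "\<sigma> ` H = H"
  shows "slide R H (\<pi> \<circ> \<sigma>) (\<rho> \<circ> \<sigma>)"
  using assms(1)
proof induction
  case (step \<rho> h v)
  have "h \<in> \<sigma> ` H"
    using step.hyps(2) by (simp only: assms(2))
  then obtain h' where "h' \<in> H" "\<sigma> h' = h" by blast
  then have "slide R H (\<pi> \<circ> \<sigma>) (Transposition.transpose (\<rho> h) v \<circ> (\<rho> \<circ> \<sigma>))"
    using step.hyps by (intro slide_move[OF step.IH, where h = h']) simp_all
  then show ?case
    by (simp only: o_assoc)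
qed (rule slide.refl)

lemma slide_id_comp:
  assumes "slide R H id \<sigma>" "slide R H id \<tau>" "\<tau> ` H = H"
  shows "slide R H id (\<sigma> \<circ> \<tau>)"
  using slide_trans[OF assms(2)] slide_comp[OF assms(1,3)] by (simp only: id_o)

lemma slide_permutes:
  assumes "slide R H \<pi> \<rho>" "\<pi> permutes V" "R \<subseteq> V \<times> V"
  shows "\<rho> permutes V"
  using assms(1)
proof induction
  case (step \<rho> h v)
  then have "Transposition.transpose (\<rho> h) v permutes V"
    using assms(3) by (intro permutes_swap_id) auto
  then show ?case
    by (rule permutes_compose[OF step.IH])
qed (rule assms)

lemma slide_inj:
  assumes "slide R H \<pi> \<rho>" "inj \<pi>"
  shows "inj \<rho>"
  using assms(1)
proof induction
  case (step \<rho> h v)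
  then show ?case by (intro inj_compose) simp_all
qed (rule assms)

lemma slide_within:
  assumes "slide R H \<pi> \<rho>" "R \<subseteq> S \<times> S"
  shows "\<rho> x = \<pi> x \<or> \<pi> x \<in> S \<and> \<rho> x \<in> S"
  using assms(1)
proof induction
  case (step \<rho> h v)
  then have "\<rho> h \<in> S" "v \<in> S" using assms(2) by blast+
  then show ?case
    using step.IH by (simp add: Transposition.transpose_def) metis
qed simp

section \<open>Interchangeable tokens\<close>

abbreviation swappable :: "('a \<times> 'a) set \<Rightarrow> 'a set \<Rightarrow> 'a \<Rightarrow> 'a \<Rightarrow> bool" where
  "swappable R H a b \<equiv> slide R H id (Transposition.transpose a b)"

lemma transpose_image_disjoint:
  assumes "a \<notin> H" "b \<notin> H"
  shows "Transposition.transpose a b ` H = H"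
proof -
  have "Transposition.transpose a b x = x" if "x \<in> H" for x
    using assms that by (auto simp: Transposition.transpose_def)
  then show ?thesis by simp
qed

lemma swappable_sym: "swappable R H a b \<Longrightarrow> swappable R H b a"
  by (simp add: transpose_commute)

text \<open>Conjugation: \<open>(a c) = (a b)(b c)(a b)\<close>. The labels must be tokens so that
  each factor preserves \<open>H\<close> and the factors can be composed as slides.\<close>

lemma swappable_trans:
  assumes "swappable R H a b" "swappable R H b c" "a \<notin> H" "b \<notin> H" "c \<notin> H"
  shows "swappable R H a c"
proof (cases "a = c \<or> a = b \<or> b = c")
  case True
  then show ?thesis
    using assms(1,2) by (elim disjE) (simp_all only: transpose_same slide.refl)
next
  case False
  let ?ab = "Transposition.transpose a b" and ?bc = "Transposition.transpose b c"
  have "(?bc \<circ> ?ab) ` H = H"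
    using transpose_image_disjoint[OF assms(3,4)] transpose_image_disjoint[OF assms(4,5)]
    by (simp only: image_comp[symmetric])
  then have "slide R H id (?ab \<circ> (?bc \<circ> ?ab))"
    using assms by (intro slide_id_comp transpose_image_disjoint)
  moreover have "?ab \<circ> (?bc \<circ> ?ab) = Transposition.transpose a c"
    using False by (auto simp: Transposition.transpose_def fun_eq_iff)
  ultimately show ?thesis by simp
qed

text \<open>An exchange carried out in any reachable position counts: go to \<open>\<pi>\<close>,
  exchange there, and retrace the way with the names \<open>a\<close> and \<open>b\<close>
  interchanged.\<close>

lemma swappableI:
  assumes "slide R H id \<pi>" "slide R H \<pi> (\<pi> \<circ> Transposition.transpose a b)"
    and "a \<notin> H" "b \<notin> H" "sym R"
  shows "swappable R H a b"
proof -
  let ?t = "Transposition.transpose a b"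
  have "slide R H (\<pi> \<circ> ?t) ?t"
    using slide_comp[OF slide_sym[OF assms(1,5)] transpose_image_disjoint[OF assms(3,4)]] by simp
  then show ?thesis
    by (rule slide_trans[OF slide_trans[OF assms(1,2)]])
qed

text \<open>With holes at the centre and at one leaf of a star, each of the tokens at two other leaves
  can be parked on the free leaf while the other one passes.\<close>

lemma star_swappable:
  assumes "slide R {g, g'} id \<pi>" "sym R"
    and star: "(v, x) \<in> R" "(v, y) \<in> R" "(v, z) \<in> R" "v \<notin> {x, y, z}" "distinct [x, y, z]"
    and pos: "\<pi> g = v" "\<pi> g' = z" "\<pi> a = x" "\<pi> b = y"
  shows "swappable R {g, g'} a b"
proof (rule swappableI[OF assms(1)])
  let ?T = "Transposition.transpose"
  have edges [simp]: "(v, x) \<in> R" "(v, y) \<in> R" "(v, z) \<in> R" "(x, v) \<in> R" "(y, v) \<in> R" "(z, v) \<in> R"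
    using star symD[OF assms(2) star(1)] symD[OF assms(2) star(2)] symD[OF assms(2) star(3)] by simp_all
  have "a \<noteq> g" "a \<noteq> g'" "b \<noteq> g" "b \<noteq> g'"
    using star(4,5) pos by auto
  then show "a \<notin> {g, g'}" "b \<notin> {g, g'}" by simp_all
  note pos[simp]
  have ne [simp]: "v \<noteq> x" "v \<noteq> y" "v \<noteq> z" "x \<noteq> v" "y \<noteq> v" "z \<noteq> v"
    "x \<noteq> y" "y \<noteq> x" "x \<noteq> z" "z \<noteq> x" "y \<noteq> z" "z \<noteq> y"
    using star by auto
  have inj: "inj \<pi>"
    using assms(1) slide_inj inj_on_id by blast
  \<comment> \<open>The schedule: \<open>a\<close> goes to \<open>v\<close> and is parked on
    \<open>z\<close> (\<open>?p1\<close>, \<open>?p2\<close>), \<open>b\<close> crosses to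
    \<open>x\<close> (\<open>?p3\<close>, \<open>?p4\<close>), \<open>a\<close> leaves
    \<open>z\<close> for \<open>y\<close> (\<open>?p5\<close>, \<open>?p6\<close>). The last move
    exchanges the two holes, which brings both of them home.\<close>
  let ?p1 = "?T v x \<circ> \<pi>"
  let ?p2 = "?T z v \<circ> ?p1"
  let ?p3 = "?T v y \<circ> ?p2"
  let ?p4 = "?T x v \<circ> ?p3"
  let ?p5 = "?T v z \<circ> ?p4"
  let ?p6 = "?T y v \<circ> ?p5"
  let ?p7 = "?T v z \<circ> ?p6"
  let ?H = "{g, g'}"
  have "slide R ?H \<pi> ?p1"
    by (rule slide_move[OF slide.refl, where h = g]) simp_all
  then have "slide R ?H \<pi> ?p2"
    by (rule slide_move[where h = g']) (simp_all add: Transposition.transpose_def)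
  then have "slide R ?H \<pi> ?p3"
    by (rule slide_move[where h = g']) (simp_all add: Transposition.transpose_def)
  then have "slide R ?H \<pi> ?p4"
    by (rule slide_move[where h = g]) (simp_all add: Transposition.transpose_def)
  then have "slide R ?H \<pi> ?p5"
    by (rule slide_move[where h = g]) (simp_all add: Transposition.transpose_def)
  then have "slide R ?H \<pi> ?p6"
    by (rule slide_move[where h = g']) (simp_all add: Transposition.transpose_def)
  then have "slide R ?H \<pi> ?p7"
    by (rule slide_move[where h = g']) (simp_all add: Transposition.transpose_def)
  moreover have "?T v z (?T y v (?T v z (?T x v (?T v y (?T z v (?T v x w)))))) = ?T x y w" for w
  proof -
    consider "w = v" | "w = x" | "w = y" | "w = z" | "w \<notin> {v, x, y, z}" by blast
    then show ?thesis
      by cases (simp_all add: Transposition.transpose_def)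
  qed
  then have "?p7 = ?T x y \<circ> \<pi>"
    by (simp add: fun_eq_iff)
  moreover have "?T x y \<circ> \<pi> = \<pi> \<circ> ?T a b"
  proof
    fix w
    show "(?T x y \<circ> \<pi>) w = (\<pi> \<circ> ?T a b) w"
    proof (cases "w = a \<or> w = b")
      case False
      then have "\<pi> w \<noteq> x" "\<pi> w \<noteq> y" using inj pos by (metis injD)+
      then show ?thesis using False by simp
    qed auto
  qed
  ultimately show "slide R ?H \<pi> (\<pi> \<circ> ?T a b)" by (simp only:)
  show "sym R" by fact
qed

section \<open>Steering the holes along walks\<close>

lemma slide_hole:
  assumes "(\<pi> h, q) \<in> R\<^sup>*" "h \<in> H"
  shows "\<exists>\<rho>. slide R H \<pi> \<rho> \<and> \<rho> h = q"
  using assms(1)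
proof induction
  case (step y z)
  then obtain \<rho> where "slide R H \<pi> \<rho>" "\<rho> h = y" by blast
  then have "slide R H \<pi> (Transposition.transpose y z \<circ> \<rho>)"
    using step.hyps assms(2) by (intro slide_move) auto
  then show ?case
    using \<open>\<rho> h = y\<close> by (intro exI conjI) (assumption, simp)
qed (auto intro: slide.refl)

text \<open>The second hole follows a walk to \<open>q\<close>; when the walk crosses \<open>p\<close>, the
  holes exchange their roles.\<close>

lemma slide_two_holes:
  assumes "sym R" "irrefl R" and holes: "H = {h, h'}" "h \<noteq> h'" and "inj \<pi>"
    and S: "R \<subseteq> S \<times> S" "\<pi> ` H \<subseteq> S" "p \<in> S" "q \<in> S"
    and con: "\<And>u v. u \<in> S \<Longrightarrow> v \<in> S \<Longrightarrow> (u, v) \<in> R\<^sup>*" and "p \<noteq> q"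
  shows "\<exists>\<rho> g g'. slide R H \<pi> \<rho> \<and> H = {g, g'} \<and> g \<noteq> g' \<and> \<rho> g = p \<and> \<rho> g' = q"
proof -
  let ?T = "Transposition.transpose"
  obtain \<pi>1 where \<pi>1: "slide R H \<pi> \<pi>1" "\<pi>1 h = p"
    using slide_hole[of \<pi> h p R H] con S holes by blast
  have "inj \<pi>1" using \<pi>1 \<open>inj \<pi>\<close> slide_inj by blast
  then have ne: "\<pi>1 h' \<noteq> p" using \<pi>1(2) holes(2) by (auto dest: injD)
  have "\<pi>1 h' \<in> S"
    using slide_within[OF \<pi>1(1) S(1), of h'] S(2) holes(1) by auto
  \<comment> \<open>Both holes cannot be on \<open>p\<close>. While the walk stands on
    \<open>p\<close>, the invariant only asks that the second hole waits on a neighbour of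
    \<open>p\<close>.\<close>
  from con[OF this \<open>q \<in> S\<close>]
  have "\<exists>\<rho> g g'. slide R H \<pi> \<rho> \<and> H = {g, g'} \<and> g \<noteq> g' \<and> \<rho> g = p \<and>
      (if q = p then (p, \<rho> g') \<in> R else \<rho> g' = q)"
  proof induction
    case base
    then show ?case using \<pi>1 holes ne by auto
  next
    case (step y z)
    then obtain \<rho> g g' where r: "slide R H \<pi> \<rho>" "H = {g, g'}" "g \<noteq> g'" "\<rho> g = p"
      "if y = p then (p, \<rho> g') \<in> R else \<rho> g' = y" by blast
    have "y \<noteq> z" using step.hyps(2) \<open>irrefl R\<close> by (auto simp: irrefl_def)
    consider "y \<noteq> p" "z = p" | "y \<noteq> p" "z \<noteq> p" | "y = p" "\<rho> g' = z" | "y = p" "\<rho> g' \<noteq> z"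
      by blast
    then show ?case
    proof cases
      case 1
      then have "(p, \<rho> g') \<in> R" using r(5) symD[OF \<open>sym R\<close> step.hyps(2)] by simp
      then show ?thesis using r 1 by (intro exI[of _ \<rho>] exI[of _ g] exI[of _ g']) simp
    next
      case 2
      have "slide R H \<pi> (?T y z \<circ> \<rho>)"
        using r(2,5) 2 step.hyps(2) by (intro slide_move[OF r(1), where h = g']) simp_all
      moreover have "(?T y z \<circ> \<rho>) g = p" "(?T y z \<circ> \<rho>) g' = z"
        using r(4,5) 2 by simp_all
      ultimately show ?thesis
        using r(2,3) 2 by (intro exI[of _ "?T y z \<circ> \<rho>"] exI[of _ g] exI[of _ g'] conjI) (assumption | simp)+
    next
      case 3
      then show ?thesis
        using r \<open>y \<noteq> z\<close> by (intro exI[of _ \<rho>] exI[of _ g] exI[of _ g'] conjI) (assumption | simp)+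
    next
      case 4
      \<comment> \<open>The walk leaves \<open>p\<close> for a vertex other than the one where
        \<open>g'\<close> waits: \<open>g\<close> goes ahead to \<open>z\<close>, and
        \<open>g'\<close> takes over its place on \<open>p\<close>.\<close>
      let ?\<rho>1 = "?T p z \<circ> \<rho>"
      let ?\<rho>2 = "?T (\<rho> g') p \<circ> ?\<rho>1"
      have rg: "(p, \<rho> g') \<in> R" "\<rho> g' \<noteq> p"
        using r 4 \<open>irrefl R\<close> by (auto simp: irrefl_def)
      have "slide R H \<pi> ?\<rho>1"
        using r(2,4) 4 step.hyps(2) by (intro slide_move[OF r(1), where h = g]) simp_all
      then have "slide R H \<pi> ?\<rho>2"
        using r(2) 4 rg symD[OF \<open>sym R\<close> rg(1)] by (intro slide_move[where h = g' and \<rho> = ?\<rho>1]) simp_all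
      moreover have "?\<rho>2 g' = p" "?\<rho>2 g = z"
        using r(4) 4 rg \<open>y \<noteq> z\<close> by simp_all
      ultimately show ?thesis
        using r(2,3) 4 \<open>y \<noteq> z\<close>
        by (intro exI[of _ ?\<rho>2] exI[of _ g'] exI[of _ g] conjI) (assumption | simp add: insert_commute)+
    qed
  qed
  then show ?thesis using \<open>p \<noteq> q\<close> by simp
qed

lemma exists_not_in_card:
  assumes "card A < card B" "finite A" shows "\<exists>x\<in>B. x \<notin> A"
  using assms by (meson card_mono linorder_not_less subsetI)

section \<open>Uniform vertex sets\<close>

text \<open>The absence of bridges is stated through cuts because every use chooses a vertex set and
  asks for an edge, or a second edge, that leaves it. An edge is two arcs, so both orientations are
  excluded.\<close>

locale bridgeless_graph =
  fixes V :: "'a set" and E :: "('a \<times> 'a) set"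
  assumes finite_V: "finite V"
    and E_subset: "E \<subseteq> V \<times> V"
    and sym_E: "sym E"
    and irrefl_E: "irrefl E"
    and cut_edge: "A \<subset> V \<Longrightarrow> A \<noteq> {} \<Longrightarrow> \<exists>a\<in>A. \<exists>b\<in>V - A. (a, b) \<in> E"
    and cut_another_edge: "A \<subset> V \<Longrightarrow> A \<noteq> {} \<Longrightarrow> (u, v) \<in> E \<Longrightarrow>
      \<exists>a\<in>A. \<exists>b\<in>V - A. (a, b) \<in> E \<and> (a, b) \<noteq> (u, v) \<and> (a, b) \<noteq> (v, u)"
begin

lemma E_sym: "(u, v) \<in> E \<Longrightarrow> (v, u) \<in> E"
  using sym_E by (rule symD)

lemma E_irrefl: "(u, u) \<notin> E"
  using irrefl_E by (simp add: irrefl_def)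

lemma E_in_V: "(u, v) \<in> E \<Longrightarrow> u \<in> V" "(u, v) \<in> E \<Longrightarrow> v \<in> V"
  using E_subset by blast+

definition connected_in :: "'a set \<Rightarrow> bool" where
  "connected_in S \<longleftrightarrow> (\<forall>u\<in>S. \<forall>v\<in>S. (u, v) \<in> (E \<inter> S \<times> S)\<^sup>*)"

lemma connected_in_insert:
  assumes "connected_in S" "s \<in> S" "(s, x) \<in> E"
  shows "connected_in (insert x S)"
proof -
  let ?R = "E \<inter> insert x S \<times> insert x S"
  have "(E \<inter> S \<times> S)\<^sup>* \<subseteq> ?R\<^sup>*" by (intro rtrancl_mono) blast
  then have old: "(u, v) \<in> ?R\<^sup>*" if "u \<in> S" "v \<in> S" for u v
    using assms(1) that unfolding connected_in_def by blast
  have "(s, x) \<in> ?R" "(x, s) \<in> ?R" using assms E_sym by auto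
  then have "(u, x) \<in> ?R\<^sup>*" "(x, u) \<in> ?R\<^sup>*" if "u \<in> S" for u
    using old[OF that \<open>s \<in> S\<close>] old[OF \<open>s \<in> S\<close> that]
    by (meson rtrancl_into_rtrancl converse_rtrancl_into_rtrancl)+
  then show ?thesis
    using old unfolding connected_in_def by auto
qed

text \<open>\<open>uniform H S\<close>: the tokens that share \<open>S\<close> with all the holes in some reachable position
  are pairwise interchangeable.\<close>

definition uniform :: "'a set \<Rightarrow> 'a set \<Rightarrow> bool" where
  "uniform H S \<longleftrightarrow> (\<forall>\<pi> a b. slide E H id \<pi> \<longrightarrow> \<pi> ` H \<subseteq> S \<longrightarrow> a \<notin> H \<longrightarrow> b \<notin> H \<longrightarrow>
     \<pi> a \<in> S \<longrightarrow> \<pi> b \<in> S \<longrightarrow> swappable E H a b)"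

lemma uniformD:
  assumes "uniform H S" "slide E H id \<pi>" "\<pi> ` H \<subseteq> S" "a \<notin> H" "b \<notin> H" "\<pi> a \<in> S" "\<pi> b \<in> S"
  shows "swappable E H a b"
  using assms unfolding uniform_def by blast

text \<open>Normalises the position of the holes. All moves stay inside \<open>S\<close>, hence the
  same labels occupy \<open>S\<close> before and after, and a claim about them can be checked with
  the holes wherever it is convenient.\<close>

lemma slide_two_holes_in:
  assumes "connected_in S" "slide E H id \<pi>" "H = {h, h'}" "h \<noteq> h'" "\<pi> ` H \<subseteq> S"
    and "p \<in> S" "q \<in> S" "p \<noteq> q"
  obtains \<rho> g g' where "slide E H id \<rho>" "H = {g, g'}" "g \<noteq> g'" "\<rho> g = p" "\<rho> g' = q"
    "\<And>x. \<rho> x \<in> S \<longleftrightarrow> \<pi> x \<in> S"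
proof -
  let ?R = "E \<inter> S \<times> S"
  have "inj \<pi>" using slide_inj[OF assms(2)] by simp
  have "sym ?R" "irrefl ?R"
    using E_sym E_irrefl by (auto simp: sym_def irrefl_def)
  have con: "?R \<subseteq> S \<times> S" "\<And>u v. u \<in> S \<Longrightarrow> v \<in> S \<Longrightarrow> (u, v) \<in> ?R\<^sup>*"
    using assms(1) unfolding connected_in_def by simp_all
  obtain \<rho> g g' where r: "slide ?R H \<pi> \<rho>" "H = {g, g'}" "g \<noteq> g'" "\<rho> g = p" "\<rho> g' = q"
    using slide_two_holes[OF \<open>sym ?R\<close> \<open>irrefl ?R\<close> assms(3,4) \<open>inj \<pi>\<close> con(1) assms(5-7) con(2) assms(8)]
    by blast
  show thesis
  proof
    show "slide E H id \<rho>"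
      using slide_trans[OF assms(2) slide_mono[OF r(1)]] by blast
    show "\<rho> x \<in> S \<longleftrightarrow> \<pi> x \<in> S" for x
      using slide_within[OF r(1), of S x] by auto
  qed fact+
qed

text \<open>The starting set of the growth: with the holes steered to \<open>v\<close> and
  \<open>z\<close>, the only tokens left in the star are on \<open>x\<close> and \<open>y\<close>,
  and \<open>star_swappable\<close> exchanges them.\<close>

lemma uniform_star:
  assumes "H = {h, h'}" "h \<noteq> h'"
    and "(v, x) \<in> E" "(v, y) \<in> E" "(v, z) \<in> E" "distinct [x, y, z]"
  shows "uniform H {v, x, y, z}" "connected_in {v, x, y, z}" "card {v, x, y, z} = 4" "{v, x, y, z} \<subseteq> V"
proof -
  let ?S = "{v, x, y, z}"
  have ne: "v \<notin> {x, y, z}" using assms E_irrefl by auto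
  then show "card ?S = 4" using assms by simp
  show "?S \<subseteq> V" using assms E_in_V by blast
  have "connected_in {v}" by (simp add: connected_in_def)
  then have "connected_in {x, v}"
    by (rule connected_in_insert[where s = v]) (use assms in simp_all)
  then have "connected_in {y, x, v}"
    by (rule connected_in_insert[where s = v]) (use assms in simp_all)
  then have "connected_in {z, y, x, v}"
    by (rule connected_in_insert[where s = v]) (use assms in simp_all)
  moreover have "{z, y, x, v} = ?S" by blast
  ultimately show con: "connected_in ?S" by (simp only:)
  show "uniform H ?S"
    unfolding uniform_def
  proof (intro allI impI)
    fix \<pi> a b
    assume pi: "slide E H id \<pi>" "\<pi> ` H \<subseteq> ?S" and ab: "a \<notin> H" "b \<notin> H" "\<pi> a \<in> ?S" "\<pi> b \<in> ?S"
    obtain \<rho> g g' where r: "slide E H id \<rho>" "H = {g, g'}" "g \<noteq> g'" "\<rho> g = v" "\<rho> g' = z"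
      "\<And>t. \<rho> t \<in> ?S \<longleftrightarrow> \<pi> t \<in> ?S"
      using slide_two_holes_in[OF con pi(1) assms(1,2) pi(2), of v z] ne by blast
    have inj: "inj \<rho>" using slide_inj[OF r(1)] by simp
    have "\<rho> t \<in> {x, y}" if "t \<notin> H" "\<pi> t \<in> ?S" for t
    proof -
      have "\<rho> t \<noteq> v" "\<rho> t \<noteq> z"
        using that(1) r(2,4,5) inj by (metis injD insertCI)+
      then show ?thesis using r(6)[of t] that(2) by simp
    qed
    then have pos: "\<rho> a \<in> {x, y}" "\<rho> b \<in> {x, y}" using ab by simp_all
    show "swappable E H a b"
    proof (cases "a = b")
      case True
      then show ?thesis by (simp only: transpose_same slide.refl)
    next
      case False
      then have "\<rho> a \<noteq> \<rho> b" using inj by (auto dest: injD)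
      then have "distinct [\<rho> a, \<rho> b, z]" "(v, \<rho> a) \<in> E" "(v, \<rho> b) \<in> E" "v \<notin> {\<rho> a, \<rho> b, z}"
        using pos assms(3-6) ne by auto
      then have "swappable E {g, g'} a b"
        using r(1,4,5) assms(5)
        by (intro star_swappable[of E g g' \<rho> v "\<rho> a" "\<rho> b" z a b] sym_E) (simp_all only: r(2) not_False_eq_True)
      then show ?thesis by (simp only: r(2))
    qed
  qed
qed

text \<open>With the holes steered to \<open>p\<close> and \<open>q\<close>, only the token on
  \<open>x\<close> is not yet covered by the uniformity of \<open>S\<close>. By transitivity it
  suffices to exchange it with a single token of \<open>S\<close>.\<close>

lemma uniform_insertI:
  assumes S: "uniform H S" "connected_in S" "s \<in> S" "(s, x) \<in> E"
    and H: "H = {h, h'}" "h \<noteq> h'"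
    and pq: "p \<in> S" "q \<in> S" "p \<noteq> q"
    and new: "\<And>\<pi> g g' b. slide E H id \<pi> \<Longrightarrow> H = {g, g'} \<Longrightarrow> g \<noteq> g' \<Longrightarrow> \<pi> g = p \<Longrightarrow> \<pi> g' = q \<Longrightarrow>
        b \<notin> H \<Longrightarrow> \<pi> b = x \<Longrightarrow> \<exists>a. a \<notin> H \<and> \<pi> a \<in> S \<and> swappable E H a b"
  shows "uniform H (insert x S)"
  unfolding uniform_def
proof (intro allI impI)
  fix \<pi> a b
  assume pi: "slide E H id \<pi>" "\<pi> ` H \<subseteq> insert x S"
    and ab: "a \<notin> H" "b \<notin> H" "\<pi> a \<in> insert x S" "\<pi> b \<in> insert x S"
  obtain \<rho> g g' where r: "slide E H id \<rho>" "H = {g, g'}" "g \<noteq> g'" "\<rho> g = p" "\<rho> g' = q"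
    "\<And>t. \<rho> t \<in> insert x S \<longleftrightarrow> \<pi> t \<in> insert x S"
    using slide_two_holes_in[OF connected_in_insert[OF S(2-4)] pi(1) H pi(2), of p q] pq by blast
  have holes: "\<rho> ` H \<subseteq> S" using r(2,4,5) pq by auto
  have rep: "\<exists>t'. t' \<notin> H \<and> \<rho> t' \<in> S \<and> swappable E H t' t" if "t \<notin> H" "\<rho> t \<in> insert x S" for t
  proof (cases "\<rho> t \<in> S")
    case True
    then have "swappable E H t t" using uniformD[OF S(1) r(1) holes] that(1) by blast
    then show ?thesis using True that(1) by blast
  next
    case False
    then show ?thesis using new[OF r(1-5) that(1)] that(2) by blast
  qed
  obtain a' b' where "a' \<notin> H" "\<rho> a' \<in> S" "swappable E H a' a" "b' \<notin> H" "\<rho> b' \<in> S" "swappable E H b' b"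
    using rep[OF ab(1) r(6)[THEN iffD2, OF ab(3)]] rep[OF ab(2) r(6)[THEN iffD2, OF ab(4)]] by blast
  moreover from this have "swappable E H a' b'"
    using uniformD[OF S(1) r(1) holes] by blast
  ultimately show "swappable E H a b"
    using swappable_trans[OF swappable_trans[OF swappable_sym]] ab(1,2) by metis
qed

text \<open>The hole on \<open>s\<close> steps to \<open>x\<close>, which pulls the token
  \<open>b\<close> from \<open>x\<close> into \<open>S\<close>. It then runs through the outside to
  \<open>y\<close> and reenters \<open>S\<close> at \<open>s'\<close>. Now both holes and
  \<open>b\<close> are in \<open>S\<close>, where uniformity applies; the price is the content of
  \<open>s'\<close>, pushed out to \<open>y\<close>.\<close>

lemma uniform_insert_ear:
  assumes S: "uniform H S" "connected_in S" "4 \<le> card S" "S \<subseteq> V"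
    and H: "H = {h, h'}" "h \<noteq> h'"
    and ear: "s \<in> S" "(s, x) \<in> E" "x \<notin> S" "(x, y) \<in> (E \<inter> (- S) \<times> (- S))\<^sup>*" "(y, s') \<in> E" "s' \<in> S" "s' \<noteq> s"
  shows "uniform H (insert x S)"
proof -
  \<comment> \<open>\<open>q\<close> houses the second hole and \<open>p\<close> the partner token
    \<open>a\<close>. Both must avoid \<open>s\<close> and \<open>s'\<close>, whose contents change;
    this takes four vertices.\<close>
  have "card {s, s'} < card S" using S(3) \<open>s' \<noteq> s\<close> by simp
  then obtain q where q: "q \<in> S" "q \<noteq> s" "q \<noteq> s'" using exists_not_in_card by blast
  have "card {s, s', q} < card S" using S(3) \<open>s' \<noteq> s\<close> q by simp
  then obtain p where p: "p \<in> S" "p \<noteq> s" "p \<noteq> s'" "p \<noteq> q"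
    using exists_not_in_card by (metis finite.simps insert_iff)
  have "y \<notin> S" using ear(4) \<open>x \<notin> S\<close> by (induction) auto
  show ?thesis
  proof (rule uniform_insertI[OF S(1,2) ear(1,2) H(1,2) \<open>s \<in> S\<close> \<open>q \<in> S\<close> \<open>q \<noteq> s\<close>[symmetric]])
    fix \<pi> g g' b
    assume pi: "slide E H id \<pi>" and g: "H = {g, g'}" "g \<noteq> g'" "\<pi> g = s" "\<pi> g' = q"
      and b: "b \<notin> H" "\<pi> b = x"
    let ?\<pi>1 = "Transposition.transpose s x \<circ> \<pi>"
    have perm: "\<pi> permutes V" using slide_permutes[OF pi permutes_id E_subset] .
    have "p \<in> V" using p S(4) by blast
    then obtain a where a: "\<pi> a = p" using permutes_surj[OF perm] by (metis surjD)
    have "a \<notin> H" using a g p by auto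
    have pi1: "slide E H id ?\<pi>1"
      using g by (intro slide_move[OF pi _ \<open>\<pi> g = s\<close> ear(2)]) simp
    have sx: "s \<noteq> x" using ear by blast
    have val1: "?\<pi>1 g = x" "?\<pi>1 g' = q" "?\<pi>1 a = p" "?\<pi>1 b = s"
      using g a b p q ear sx by (auto simp: Transposition.transpose_def)
    obtain \<pi>2 where pi2: "slide (E \<inter> (- S) \<times> (- S)) H ?\<pi>1 \<pi>2" "\<pi>2 g = y"
      using slide_hole[of ?\<pi>1 g y "E \<inter> (- S) \<times> (- S)" H] val1(1) ear(4) g(1) by (metis insertI1)
    have keep: "\<pi>2 t = ?\<pi>1 t" if "?\<pi>1 t \<in> S" for t
      using slide_within[OF pi2(1), of "- S" t] that by auto
    have val2: "\<pi>2 g' = q" "\<pi>2 a = p" "\<pi>2 b = s"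
      using keep[of g'] keep[of a] keep[of b] val1 q p ear(1) by metis+
    have pi2': "slide E H id \<pi>2"
      using slide_trans[OF pi1 slide_mono[OF pi2(1)]] by blast
    let ?\<pi>3 = "Transposition.transpose y s' \<circ> \<pi>2"
    have pi3: "slide E H id ?\<pi>3"
      using g(1) by (intro slide_move[OF pi2' _ pi2(2) ear(5)]) simp
    have val3: "?\<pi>3 g = s'" "?\<pi>3 g' = q" "?\<pi>3 a = p" "?\<pi>3 b = s"
      using val2 pi2(2) \<open>y \<notin> S\<close> q p ear by (auto simp: Transposition.transpose_def)
    have "?\<pi>3 ` H \<subseteq> S" using val3 g(1) ear q by auto
    then have "swappable E H a b"
      using uniformD[OF S(1) pi3] \<open>a \<notin> H\<close> \<open>b \<notin> H\<close> val3 p ear by metis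
    then show "\<exists>a. a \<notin> H \<and> \<pi> a \<in> S \<and> swappable E H a b"
      using a p \<open>a \<notin> H\<close> by blast
  qed
qed

text \<open>The hole on \<open>s\<close> steps out to \<open>y\<close> and the hole on
  \<open>q\<close> follows to \<open>s\<close>, so that centre and outer leaf are free while
  \<open>p\<close> and \<open>x\<close> carry the two tokens of a star exchange. The leaf
  \<open>q\<close> takes up the former content of \<open>y\<close>.\<close>

lemma uniform_insert_branch:
  assumes S: "uniform H S" "connected_in S" "S \<subseteq> V"
    and H: "H = {h, h'}" "h \<noteq> h'"
    and s: "s \<in> S" "(s, x) \<in> E" "x \<notin> S" "(s, y) \<in> E" "y \<notin> S" "x \<noteq> y"
      "(s, p) \<in> E" "p \<in> S" "(s, q) \<in> E" "q \<in> S" "p \<noteq> q"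
  shows "uniform H (insert x S)"
proof -
  have "s \<noteq> q" "s \<noteq> p" using s E_irrefl by auto
  show ?thesis
  proof (rule uniform_insertI[OF S(1,2) s(1,2) H(1,2) \<open>s \<in> S\<close> \<open>q \<in> S\<close> \<open>s \<noteq> q\<close>])
    fix \<pi> g g' b
    assume pi: "slide E H id \<pi>" and g: "H = {g, g'}" "g \<noteq> g'" "\<pi> g = s" "\<pi> g' = q"
      and b: "b \<notin> H" "\<pi> b = x"
    have perm: "\<pi> permutes V" using slide_permutes[OF pi permutes_id E_subset] .
    have "p \<in> V" using s S(3) by blast
    then obtain a where a: "\<pi> a = p" using permutes_surj[OF perm] by (metis surjD)
    have "a \<notin> H" using a g s \<open>s \<noteq> p\<close> by auto
    let ?\<pi>1 = "Transposition.transpose s y \<circ> \<pi>"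
    let ?\<pi>2 = "Transposition.transpose q s \<circ> ?\<pi>1"
    have ne: "s \<noteq> x" "s \<noteq> y" "q \<noteq> x" "q \<noteq> y" "p \<noteq> x" "p \<noteq> y" using s by auto
    have pi1: "slide E H id ?\<pi>1"
      using g by (intro slide_move[OF pi _ \<open>\<pi> g = s\<close> \<open>(s, y) \<in> E\<close>]) simp
    have val1: "?\<pi>1 g = y" "?\<pi>1 g' = q" "?\<pi>1 a = p" "?\<pi>1 b = x"
      using g a b ne s \<open>s \<noteq> p\<close> \<open>s \<noteq> q\<close> by (simp_all add: Transposition.transpose_def)
    have pi2: "slide E H id ?\<pi>2"
      using g(1) by (intro slide_move[OF pi1 _ val1(2) E_sym[OF \<open>(s, q) \<in> E\<close>]]) simp
    have "(Transposition.transpose q s \<circ> f) t = Transposition.transpose q s (f t)" for f and t :: 'a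
      by simp
    then have val2: "?\<pi>2 g = y" "?\<pi>2 g' = s" "?\<pi>2 a = p" "?\<pi>2 b = x"
      using ne s \<open>s \<noteq> p\<close> \<open>s \<noteq> q\<close> by (simp_all only: val1) (simp_all add: Transposition.transpose_def)
    have H': "H = {g', g}" using g by blast
    have "s \<notin> {p, x, y}" "distinct [p, x, y]"
      using ne \<open>s \<noteq> p\<close> \<open>x \<noteq> y\<close> by simp_all
    then have "swappable E {g', g} a b"
      using star_swappable[of E g' g ?\<pi>2, OF pi2[unfolded H'] sym_E s(7,2,4) _ _ val2(2,1,3,4)] by blast
    then have "swappable E H a b" by (simp only: H')
    then show "\<exists>a. a \<notin> H \<and> \<pi> a \<in> S \<and> swappable E H a b"
      using a s \<open>a \<notin> H\<close> by blast
  qed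
qed

text \<open>Fix \<open>s\<close> in \<open>S\<close> with a neighbour outside. Either some excursion
  from \<open>s\<close> through the complement returns to another vertex of \<open>S\<close>, which
  is an ear, or all of them return only to \<open>s\<close>. Then two applications of
  \<open>cut_another_edge\<close> supply the second leaf on either side of a branching at
  \<open>s\<close>.\<close>

lemma uniform_extend:
  assumes S: "uniform H S" "connected_in S" "4 \<le> card S" "S \<subset> V"
    and H: "H = {h, h'}" "h \<noteq> h'"
  shows "\<exists>x\<in>V - S. uniform H (insert x S) \<and> connected_in (insert x S)"
proof -
  let ?out = "E \<inter> (- S) \<times> (- S)"
  have "S \<noteq> {}" "S \<subseteq> V" using S by auto
  then obtain s x where sx: "s \<in> S" "x \<in> V" "x \<notin> S" "(s, x) \<in> E"
    using cut_edge[OF S(4)] by blast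
  show ?thesis
  proof (cases "\<exists>x y s'. (s, x) \<in> E \<and> x \<notin> S \<and> (x, y) \<in> ?out\<^sup>* \<and> (y, s') \<in> E \<and> s' \<in> S \<and> s' \<noteq> s")
    case True
    then obtain x y s' where "(s, x) \<in> E" "x \<notin> S" "(x, y) \<in> ?out\<^sup>*" "(y, s') \<in> E" "s' \<in> S" "s' \<noteq> s"
      by blast
    then have "uniform H (insert x S)" "connected_in (insert x S)"
      using uniform_insert_ear[OF S(1-3) \<open>S \<subseteq> V\<close> H \<open>s \<in> S\<close>] connected_in_insert[OF S(2) \<open>s \<in> S\<close>] by blast+
    then show ?thesis using \<open>(s, x) \<in> E\<close> \<open>x \<notin> S\<close> E_in_V by blast
  next
    case False
    \<comment> \<open>The component of \<open>x\<close> outside \<open>S\<close>. Without an ear it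
      is attached to \<open>S\<close> only at \<open>s\<close>, and since \<open>xs\<close> is not a
      bridge there is a second edge from \<open>D\<close> to \<open>s\<close>: its end
      \<open>a\<close> is the other outer leaf.\<close>
    define D where "D = {y. (x, y) \<in> ?out\<^sup>*}"
    have step_out: "(u, y) \<in> ?out\<^sup>*" if "(u, y') \<in> ?out\<^sup>*" "u \<notin> S" "(y', y) \<in> E" "y \<notin> S" for u y y'
    proof -
      have "y' \<notin> S" using that(1,2) by induction auto
      then show ?thesis using that by (auto intro: rtrancl_into_rtrancl)
    qed
    have out_V: "y \<in> V - S" if "(u, y) \<in> ?out\<^sup>*" "u \<in> V - S" for u y
      using that(1,2) E_in_V by induction auto
    have "D \<subset> V" "x \<in> D" using out_V sx \<open>S \<noteq> {}\<close> \<open>S \<subseteq> V\<close> by (auto simp: D_def)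
    then obtain a b where ab: "a \<in> D" "b \<in> V - D" "(a, b) \<in> E" "(a, b) \<noteq> (x, s)"
      using cut_another_edge[of D s x] sx(4) by blast
    have "b \<in> S" using step_out[of x a b] ab sx by (auto simp: D_def)
    then have "b = s" using False ab sx by (auto simp: D_def)
    then have a: "(s, a) \<in> E" "a \<noteq> x" "a \<notin> S" using ab E_sym out_V[of x a] sx by (auto simp: D_def)
    \<comment> \<open>\<open>s\<close> with everything reached from it through the complement of
      \<open>S\<close>. Without an ear, edges leave \<open>A\<close> only from \<open>s\<close> into
      \<open>S\<close>, so two edges of this cut yield the inner leaves \<open>p\<close> and
      \<open>q\<close>.\<close>
    define A where "A = insert s {y. \<exists>u. (s, u) \<in> E \<and> u \<notin> S \<and> (u, y) \<in> ?out\<^sup>*}"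
    have "y \<in> V - S" if "y \<in> A" "y \<noteq> s" for y
      using that out_V E_in_V by (fastforce simp: A_def)
    moreover have "card {s} < card S" using S(3) by simp
    then obtain r where "r \<in> S" "r \<noteq> s" using exists_not_in_card[of "{s}" S] by auto
    ultimately have "A \<subset> V" "A \<noteq> {}" using sx \<open>S \<subseteq> V\<close> by (auto simp: A_def)
    have leave: "a = s \<and> b \<in> S" if lv: "a \<in> A" "b \<in> V - A" "(a, b) \<in> E" for a b
    proof (cases "a = s")
      case True
      then show ?thesis using lv by (auto simp: A_def)
    next
      case neq: False
      then obtain u where u: "(s, u) \<in> E" "u \<notin> S" "(u, a) \<in> ?out\<^sup>*" using lv by (auto simp: A_def)
      show ?thesis
      proof (cases "b \<in> S")
        case True
        then have "b = s" using False u lv(3) by blast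
        then show ?thesis using lv by (auto simp: A_def)
      next
        case False
        then have "b \<in> A" using step_out[OF u(3,2) lv(3)] u by (auto simp: A_def)
        then show ?thesis using lv by blast
      qed
    qed
    obtain p where p: "p \<in> S" "(s, p) \<in> E"
      using cut_edge[OF \<open>A \<subset> V\<close> \<open>A \<noteq> {}\<close>] leave by blast
    obtain q where q: "q \<in> S" "(s, q) \<in> E" "p \<noteq> q"
      using cut_another_edge[OF \<open>A \<subset> V\<close> \<open>A \<noteq> {}\<close> p(2)] leave by blast
    have "uniform H (insert x S)"
      using uniform_insert_branch[OF S(1,2) \<open>S \<subseteq> V\<close> H sx(1,4,3) a(1,3) a(2)[symmetric] p(2,1) q(2,1,3)] .
    then show ?thesis
      using connected_in_insert[OF S(2) sx(1,4)] sx by blast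
  qed
qed

lemma uniform_V:
  assumes H: "H = {h, h'}" "h \<noteq> h'"
    and S: "uniform H S" "connected_in S" "4 \<le> card S" "S \<subseteq> V"
  shows "uniform H V"
  using S
proof (induction "card (V - S)" arbitrary: S rule: less_induct)
  case less
  show ?case
  proof (cases "S = V")
    case True
    then show ?thesis using less.prems by simp
  next
    case False
    then have "S \<subset> V" using less.prems by blast
    then obtain x where x: "x \<in> V - S" "uniform H (insert x S)" "connected_in (insert x S)"
      using uniform_extend[OF less.prems(1-3) _ H] by blast
    have "V - insert x S \<subset> V - S" using x by blast
    then have "card (V - insert x S) < card (V - S)" using finite_V by (simp add: psubset_card_mono)
    moreover have "finite S" using less.prems(4) finite_V finite_subset by blast
    then have "4 \<le> card (insert x S)" using less.prems(3) x(1) by simp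
    ultimately show ?thesis
      using less.hyps[OF _ x(2,3)] less.prems(4) x(1) by blast
  qed
qed

text \<open>Uniformity of \<open>V\<close> is used at the identity position, where it applies to any
  two labels outside \<open>H\<close>; their transpositions generate all permutations of
  \<open>V - H\<close>.\<close>

lemma slide_any_permutation:
  assumes H: "H = {h, h'}" "h \<noteq> h'" "H \<subseteq> V"
    and star: "(v, x) \<in> E" "(v, y) \<in> E" "(v, z) \<in> E" "distinct [x, y, z]"
    and f: "f permutes V - H"
  shows "slide E H id f"
proof -
  have "uniform H V"
    using uniform_star[OF H(1,2) star] uniform_V[OF H(1,2)] by simp
  then have swaps: "swappable E H a b" if "a \<in> V - H" "b \<in> V - H" for a b
    using uniformD[OF _ slide.refl, of H V a b] that H(3) by simp
  have "finite (V - H)" using finite_V by simp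
  from f this show ?thesis
  proof (induction rule: permutes_induct)
    case id
    show ?case by (rule slide.refl)
  next
    case (swap a b p)
    have "p ` H = H"
    proof -
      have "p x = x" if "x \<in> H" for x using swap.hyps that by (auto simp: permutes_def)
      then show ?thesis by simp
    qed
    then show ?case
      using slide_id_comp[OF swaps swap.IH] swap.hyps by blast
  qed
qed

end

text \<open>Collapsing \<open>v\<close> into the hole differs from the transposition only at the
  vertex of the hole, where no token sits. The inserted \<open>id\<close> accounts for the empty
  sequence of moves.\<close>

lemma slide_imp_flow:
  assumes "slide (parcs G) H id \<pi>" "sym (parcs G)"
  shows "\<exists>s\<in>insert id (flow_semigroup G). \<forall>x. x \<notin> H \<longrightarrow> s x = \<pi> x"
  using assms(1)
proof induction
  case refl
  then show ?case by auto
next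
  case (step \<rho> h v)
  then obtain s where s: "s \<in> insert id (flow_semigroup G)" "\<And>x. x \<notin> H \<Longrightarrow> s x = \<rho> x" by blast
  have "inj \<rho>" using slide_inj[OF step.hyps(1)] by simp
  let ?c = "collapsing v (\<rho> h)"
  have "?c \<in> flow_semigroup G"
    using flow_semigroup.gen symD[OF assms(2) step.hyps(3)] by metis
  then have "?c \<circ> s \<in> flow_semigroup G"
    using s(1) flow_semigroup.mult by (metis comp_id insertE)
  moreover have "(?c \<circ> s) x = (Transposition.transpose (\<rho> h) v \<circ> \<rho>) x" if "x \<notin> H" for x
  proof -
    have "\<rho> x \<noteq> \<rho> h" using \<open>inj \<rho>\<close> that step.hyps(2) by (metis injD)
    then show ?thesis using s(2)[OF that] by (simp add: collapsing_def Transposition.transpose_def)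
  qed
  ultimately show ?case by blast
qed

section \<open>Connectivity and cycles\<close>

lemma connected_cut:
  assumes "Digraph_Component.connected (with_proj G)" "A \<subset> pverts G" "A \<noteq> {}"
  shows "\<exists>a\<in>A. \<exists>b\<in>pverts G - A. (a, b) \<in> parcs G \<or> (b, a) \<in> parcs G"
proof (rule ccontr)
  assume no: "\<not> ?thesis"
  let ?M = "mk_symmetric (with_proj G)"
  obtain a b where ab: "a \<in> A" "b \<in> pverts G" "b \<notin> A" using assms by blast
  have "a \<rightarrow>\<^sup>*\<^bsub>with_proj ?M\<^esub> b"
    using assms(1,2) ab unfolding Digraph_Component.connected_def strongly_connected_def by auto
  then have "(a, b) \<in> rtrancl_on (pverts G) (parcs ?M)"
    by (simp add: reachable_def)
  then have "b \<in> A"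
  proof (induction rule: rtrancl_on_induct)
    case base
    show ?case by fact
  next
    case (step c d)
    then have "(c, d) \<in> parcs G \<or> (d, c) \<in> parcs G"
      by (auto simp: parcs_mk_symmetric)
    then show ?case using no step by blast
  qed
  then show False using ab by blast
qed

lemma bridgeless_graph_pair_graph:
  assumes "pair_graph G" "two_edge_connected G"
  shows "bridgeless_graph (pverts G) (parcs G)"
proof -
  interpret pair_graph G by fact
  have sym: "sym (parcs G)"
    using pair_sym_arcs by (simp add: symmetric_def)
  have con: "Digraph_Component.connected (with_proj G)"
    and con': "\<And>u v. (u, v) \<in> parcs G \<Longrightarrow> Digraph_Component.connected (with_proj (remove_edge G u v))"
    using assms(2) unfolding two_edge_connected_def by blast+
  show ?thesis
  proof
    show "finite (pverts G)" by (rule pair_finite_verts)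
    show "parcs G \<subseteq> pverts G \<times> pverts G" using in_arcsD1 in_arcsD2 by auto
    show "sym (parcs G)" by fact
    show "irrefl (parcs G)" using pair_no_loops by (fastforce simp: irrefl_def)
  next
    fix A assume "A \<subset> pverts G" "A \<noteq> {}"
    then obtain a b where "a \<in> A" "b \<in> pverts G - A" "(a, b) \<in> parcs G \<or> (b, a) \<in> parcs G"
      using connected_cut[OF con] by blast
    then show "\<exists>a\<in>A. \<exists>b\<in>pverts G - A. (a, b) \<in> parcs G"
      using symD[OF sym, of b a] by blast
  next
    fix A u v assume A: "A \<subset> pverts G" "A \<noteq> {}" and "(u, v) \<in> parcs G"
    have V: "pverts (remove_edge G u v) = pverts G"
      and E: "parcs (remove_edge G u v) = parcs G - {(u, v), (v, u)}"
      by (simp_all add: remove_edge_def)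
    obtain a b where ab: "a \<in> A" "b \<in> pverts G - A"
      "(a, b) \<in> parcs G - {(u, v), (v, u)} \<or> (b, a) \<in> parcs G - {(u, v), (v, u)}"
      using connected_cut[OF con'[OF \<open>(u, v) \<in> parcs G\<close>], of A] A unfolding V E by blast
    then have "(a, b) \<in> parcs G \<and> (a, b) \<noteq> (u, v) \<and> (a, b) \<noteq> (v, u)"
      using symD[OF sym, of b a] by blast
    then show "\<exists>a\<in>A. \<exists>b\<in>pverts G - A. (a, b) \<in> parcs G \<and> (a, b) \<noteq> (u, v) \<and> (a, b) \<noteq> (v, u)"
      using ab by blast
  qed
qed

text \<open>Collapsing the holes into the tokens beforehand costs nothing, so the condition that \<open>W\<close> is
  mapped into its complement does not restrict the permutations of the tokens.\<close>

lemma flow_retraction: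
  assumes "finite W" "W \<subset> pverts G" "W \<noteq> {}"
    and cut: "\<And>A. A \<subset> pverts G \<Longrightarrow> A \<noteq> {} \<Longrightarrow> \<exists>a\<in>A. \<exists>b\<in>pverts G - A. (a, b) \<in> parcs G"
  shows "\<exists>c\<in>flow_semigroup G. (\<forall>x. x \<notin> W \<longrightarrow> c x = x) \<and> c ` W \<subseteq> pverts G - W"
  using assms(1-3)
proof (induction "card W" arbitrary: W)
  case 0
  then show ?case by simp
next
  case (Suc m)
  obtain w x where wx: "w \<in> W" "x \<in> pverts G - W" "(w, x) \<in> parcs G"
    using cut[OF Suc.prems(2,3)] by blast
  let ?c = "collapsing w x"
  have c: "?c \<in> flow_semigroup G" using wx flow_semigroup.gen by metis
  show ?case
  proof (cases "W = {w}")
    case True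
    then show ?thesis using c wx by (intro bexI[of _ ?c]) (auto simp: collapsing_def)
  next
    case False
    have "m = card (W - {w})" using Suc.hyps(2) Suc.prems(1) wx(1) by simp
    then obtain d where d: "d \<in> flow_semigroup G" "\<And>y. y \<notin> W - {w} \<Longrightarrow> d y = y"
      "d ` (W - {w}) \<subseteq> pverts G - (W - {w})"
      using Suc.hyps(1)[of "W - {w}"] Suc.prems wx(1) False by blast
    \<comment> \<open>\<open>d\<close> may leave some holes on \<open>w\<close>; the collapsing of
      \<open>w\<close> into \<open>x\<close>, performed last, clears them away together with
      \<open>w\<close> itself.\<close>
    have "?c \<circ> d \<in> flow_semigroup G" using c d(1) flow_semigroup.mult by metis
    moreover have "(?c \<circ> d) y = y" if "y \<notin> W" for y
      using that d(2) wx(1) by (auto simp: collapsing_def)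
    moreover have "(?c \<circ> d) y \<in> pverts G - W" if "y \<in> W" for y
    proof (cases "y = w")
      case True
      then show ?thesis using d(2)[of w] wx by (simp add: collapsing_def)
    next
      case False
      then have "d y \<in> pverts G - (W - {w})" using d(3) that by blast
      then show ?thesis using wx by (auto simp: collapsing_def)
    qed
    ultimately show ?thesis by (intro bexI[of _ "?c \<circ> d"]) auto
  qed
qed

text \<open>In a longest path, all neighbours of the first vertex lie on the path, and there are at
  least two since no edge is a bridge. As no vertex has three neighbours, one of them must be the
  last vertex, so the path closes up. Each of its vertices then has its two neighbours on it, no
  edge leaves it, and it spans the graph.\<close>

lemma is_cycle_graphI:
  assumes "bridgeless_graph (pverts G) (parcs G)" "pverts G \<noteq> {}" "parcs G \<noteq> {}"
    and deg: "\<And>v x y z. (v, x) \<in> parcs G \<Longrightarrow> (v, y) \<in> parcs G \<Longrightarrow> (v, z) \<in> parcs G \<Longrightarrow> \<not> distinct [x, y, z]"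
  shows "is_cycle_graph G"
proof -
  interpret bridgeless_graph "pverts G" "parcs G" by fact
  let ?V = "pverts G" and ?E = "parcs G"
  define P where "P xs \<longleftrightarrow> xs \<noteq> [] \<and> distinct xs \<and> set xs \<subseteq> ?V \<and> (\<forall>i. Suc i < length xs \<longrightarrow> (xs ! i, xs ! Suc i) \<in> ?E)" for xs
  obtain v0 where "v0 \<in> ?V" using assms(2) by blast
  then have "P [v0]" by (simp add: P_def)
  moreover have "length xs \<le> card ?V" if "P xs" for xs
    using that finite_V by (metis P_def card_mono distinct_card)
  ultimately have "\<exists>xs. P xs \<and> (\<forall>ys. P ys \<longrightarrow> length ys \<le> length xs)"
    by (intro ex_has_greatest_nat[of P "[v0]" length "Suc (card ?V)"]) (simp_all add: le_imp_less_Suc)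
  then obtain xs where xs: "P xs" and max: "\<And>ys. P ys \<Longrightarrow> length ys \<le> length xs" by blast
  define m where "m = length xs"
  have xsD: "xs \<noteq> []" "distinct xs" "set xs \<subseteq> ?V" "\<And>i. Suc i < m \<Longrightarrow> (xs ! i, xs ! Suc i) \<in> ?E"
    using xs by (auto simp: P_def m_def)
  have eq: "xs ! i = xs ! j \<longleftrightarrow> i = j" if "i < m" "j < m" for i j
    using that xsD(2) nth_eq_iff_index_eq unfolding m_def by blast
  have "m > 0" using xsD(1) by (simp add: m_def)
  have in_path: "\<exists>j<m. w = xs ! j" if "(xs ! 0, w) \<in> ?E" for w
  proof (rule ccontr)
    assume "\<not> ?thesis"
    then have "w \<notin> set xs" by (auto simp: in_set_conv_nth m_def)
    moreover have "((w # xs) ! i, (w # xs) ! Suc i) \<in> ?E" if "Suc i < length (w # xs)" for i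
      using that xsD(4) E_sym[OF \<open>(xs ! 0, w) \<in> ?E\<close>] by (cases i) (auto simp: m_def)
    ultimately have "P (w # xs)" using xsD E_in_V(2)[OF that] by (auto simp: P_def)
    then show False using max by fastforce
  qed
  have two_nbrs: "\<exists>x y. (v, x) \<in> ?E \<and> (v, y) \<in> ?E \<and> x \<noteq> y" if "v \<in> ?V" for v
  proof -
    obtain u w where "(u, w) \<in> ?E" using assms(3) by auto
    then have "u \<noteq> w" "u \<in> ?V" "w \<in> ?V" using E_irrefl E_in_V by auto
    then have "{v} \<noteq> ?V" by (metis singletonD)
    then have v: "{v} \<subset> ?V" "{v} \<noteq> {}" using that by auto
    obtain x where x: "(v, x) \<in> ?E" using cut_edge[OF v] by blast
    show ?thesis using cut_another_edge[OF v x] x by blast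
  qed
  have "xs ! 0 \<in> ?V" using xsD(3) \<open>m > 0\<close> by (auto simp: m_def)
  then obtain x y where xy: "(xs ! 0, x) \<in> ?E" "(xs ! 0, y) \<in> ?E" "x \<noteq> y"
    using two_nbrs by blast
  obtain i0 j0 where "i0 < m" "x = xs ! i0" "j0 < m" "y = xs ! j0"
    using in_path xy by metis
  then obtain i j where ij: "i < j" "j < m" "(xs ! 0, xs ! i) \<in> ?E" "(xs ! 0, xs ! j) \<in> ?E"
    using xy by (metis nat_neq_iff)
  have "i \<noteq> 0" using ij E_irrefl by metis
  \<comment> \<open>Here \<open>j\<close> is at least 2, so an inner path vertex at \<open>j\<close>
    would have its two path neighbours and the first vertex as three different neighbours.\<close>
  have j: "j = m - 1"
  proof (rule ccontr)
    assume "j \<noteq> m - 1"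
    then have "Suc j < m" using ij by simp
    then have "(xs ! j, xs ! Suc j) \<in> ?E" by (rule xsD(4))
    moreover have "(xs ! j, xs ! (j - 1)) \<in> ?E" using E_sym[OF xsD(4)[of "j - 1"]] ij by simp
    moreover have "(xs ! j, xs ! 0) \<in> ?E" using ij E_sym by blast
    moreover have "distinct [xs ! Suc j, xs ! (j - 1), xs ! 0]"
      using \<open>Suc j < m\<close> ij \<open>i \<noteq> 0\<close> eq by simp
    ultimately show False using deg by blast
  qed
  have "3 \<le> m" using j ij \<open>i \<noteq> 0\<close> by simp
  have succ: "(xs ! i, xs ! (Suc i mod m)) \<in> ?E" if "i < m" for i
  proof (cases "Suc i = m")
    case True
    then show ?thesis using j ij(4) E_sym by auto
  next
    case False
    then show ?thesis using that xsD(4) by simp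
  qed
  have pred: "(xs ! i, xs ! ((i + m - 1) mod m)) \<in> ?E" if "i < m" for i
  proof (cases i)
    case 0
    then show ?thesis using j ij \<open>3 \<le> m\<close> by simp
  next
    case (Suc i')
    then have "(i + m - 1) mod m = i'" using that by simp
    then show ?thesis using E_sym[OF succ[of i']] Suc that by simp
  qed
  have nbrs: "w = xs ! (Suc i mod m) \<or> w = xs ! ((i + m - 1) mod m)" if "i < m" "(xs ! i, w) \<in> ?E" for i w
  proof -
    have "Suc i mod m \<noteq> (i + m - 1) mod m"
    proof (cases i)
      case 0
      then show ?thesis using \<open>3 \<le> m\<close> by simp
    next
      case (Suc i')
      then have "(i + m - 1) mod m = i'" using that by simp
      moreover have "Suc i mod m \<noteq> i'"
        using Suc that \<open>3 \<le> m\<close> by (cases "Suc i = m") auto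
      ultimately show ?thesis by simp
    qed
    then have "xs ! (Suc i mod m) \<noteq> xs ! ((i + m - 1) mod m)" using eq \<open>m > 0\<close> by simp
    then show ?thesis using deg[OF succ[OF that(1)] pred[OF that(1)] that(2)] by auto
  qed
  have V: "set xs = ?V"
  proof (rule ccontr)
    assume "set xs \<noteq> ?V"
    then obtain a b where ab: "a \<in> set xs" "b \<notin> set xs" "(a, b) \<in> ?E"
      using cut_edge[of "set xs"] xsD by blast
    then obtain i where "i < m" "a = xs ! i" by (auto simp: in_set_conv_nth m_def)
    then have "b \<in> set xs" using nbrs[of i b] ab(3) \<open>m > 0\<close> by (auto simp: m_def)
    then show False using ab by blast
  qed
  have "bij_betw ((!) xs) {..<m} ?V"
    using bij_betw_nth[OF xsD(2), of "{..<m}" ?V] V by (simp add: m_def)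
  moreover have "?E = (\<Union>i<m. {(xs ! i, xs ! (Suc i mod m)), (xs ! (Suc i mod m), xs ! i)})"
  proof (intro equalityI subsetI)
    fix e assume e: "e \<in> ?E"
    obtain a b where ab: "e = (a, b)" by fastforce
    then have "a \<in> set xs" using e E_in_V V by blast
    then obtain i where i: "i < m" "a = xs ! i" by (auto simp: in_set_conv_nth m_def)
    define k where "k = (i + m - 1) mod m"
    have "k < m" "Suc k mod m = i" using i \<open>3 \<le> m\<close> by (simp_all add: k_def mod_Suc_eq)
    then show "e \<in> (\<Union>i<m. {(xs ! i, xs ! (Suc i mod m)), (xs ! (Suc i mod m), xs ! i)})"
    proof -
      consider "b = xs ! (Suc i mod m)" | "b = xs ! k" using nbrs[of i b] i ab e by (auto simp: k_def)
      then show ?thesis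
      proof cases
        case 1
        then show ?thesis using i ab by blast
      next
        case 2
        then show ?thesis using \<open>k < m\<close> \<open>Suc k mod m = i\<close> i ab by (intro UN_I[of k]) simp_all
      qed
    qed
  next
    fix e assume "e \<in> (\<Union>i<m. {(xs ! i, xs ! (Suc i mod m)), (xs ! (Suc i mod m), xs ! i)})"
    then obtain i where "i < m" "e = (xs ! i, xs ! (Suc i mod m)) \<or> e = (xs ! (Suc i mod m), xs ! i)" by blast
    then show "e \<in> ?E" using succ[of i] E_sym[OF succ[of i]] by auto
  qed
  ultimately show ?thesis
    using \<open>3 \<le> m\<close> unfolding is_cycle_graph_def by blast
qed

section \<open>The symmetric case\<close>

lemma is_symmetric_perm_group_BijGroup:
  assumes "finite X" "card X = m"
  shows "is_symmetric_perm_group (BijGroup X) X m"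
proof -
  obtain f where f: "bij_betw f X {1..m}"
    using finite_same_card_bij[of X "{1..m}"] assms by auto
  define f' where "f' = inv_into X f"
  have f': "f' i \<in> X" "f (f' i) = i" if "i \<in> {1..m}" for i
    using that bij_betw_inv_into_right[OF f] bij_betwE[OF bij_betw_inv_into[OF f]] by (auto simp: f'_def)
  have ff: "f x \<in> {1..m}" "f' (f x) = x" if "x \<in> X" for x
    using that bij_betw_inv_into_left[OF f] bij_betwE[OF f] by (auto simp: f'_def)
  have f'_bij: "bij_betw f' {1..m} X"
    unfolding f'_def by (rule bij_betw_inv_into[OF f])
  \<comment> \<open>Conjugation by \<open>f\<close> alone is not enough: members of
    \<open>Bij X\<close> are \<open>undefined\<close> outside \<open>X\<close>, whereas permutations
    of \<open>{1..m}\<close> are the identity outside. \<open>h\<close> and \<open>k\<close>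
    translate between the two defaults.\<close>
  define h where "h g = (\<lambda>i. if i \<in> {1..m} then f (g (f' i)) else i)" for g
  define k where "k p = (\<lambda>x\<in>X. f' (p (f x)))" for p
  have BijD: "g x \<in> X" if "g \<in> Bij X" "x \<in> X" for g x
    using that by (auto simp: Bij_def dest: bij_betwE)
  have h_perm: "h g permutes {1..m}" if "g \<in> Bij X" for g
  proof (rule bij_imp_permutes)
    have "bij_betw (f \<circ> (g \<circ> f')) {1..m} {1..m}"
      using that f f'_bij by (intro bij_betw_trans) (auto simp: Bij_def)
    then show "bij_betw (h g) {1..m} {1..m}"
      by (rule bij_betw_cong[THEN iffD1, rotated]) (simp add: h_def)
  qed (auto simp: h_def)
  have k_Bij: "k p \<in> Bij X" if "p permutes {1..m}" for p
  proof -
    have "bij_betw (f' \<circ> (p \<circ> f)) X X"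
      using bij_betw_trans[OF bij_betw_trans[OF f permutes_imp_bij[OF that]] f'_bij] by (simp only:)
    then have "bij_betw (k p) X X"
      by (rule bij_betw_cong[THEN iffD1, rotated]) (simp add: k_def)
    then show ?thesis by (simp add: Bij_def k_def)
  qed
  have "bij_betw h (Bij X) {p. p permutes {1..m}}"
  proof (rule bij_betw_byWitness[where f' = k])
    show "\<forall>g\<in>Bij X. k (h g) = g"
    proof
      fix g assume g: "g \<in> Bij X"
      show "k (h g) = g"
      proof (rule extensionalityI[of _ X])
        show "k (h g) \<in> extensional X" by (simp add: k_def)
        show "g \<in> extensional X" using g by (rule Bij_imp_extensional)
        show "k (h g) x = g x" if "x \<in> X" for x
          using that ff BijD[OF g that] unfolding h_def k_def by simp
      qed
    qed
    show "\<forall>p\<in>{p. p permutes {1..m}}. h (k p) = p"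
    proof
      fix p assume "p \<in> {p. p permutes {1..m}}"
      then have p: "p permutes {1..m}" by simp
      show "h (k p) = p"
      proof
        fix i
        show "h (k p) i = p i"
        proof (cases "i \<in> {1..m}")
          case True
          then have "p i \<in> {1..m}" using permutes_in_image[OF p] by blast
          then show ?thesis using True f' unfolding h_def k_def by simp
        next
          case False
          then show ?thesis using permutes_not_in[OF p False] unfolding h_def by (simp only: if_False)
        qed
      qed
    qed
  qed (use h_perm k_Bij in auto)
  moreover have "h (compose X g g') = h g \<circ> h g'" if "g \<in> Bij X" "g' \<in> Bij X" for g g'
  proof
    fix i
    show "h (compose X g g') i = (h g \<circ> h g') i"
    proof (cases "i \<in> {1..m}")
      case True
      then show ?thesis
        using f'[OF True] ff BijD[OF that(2)] by (simp add: h_def compose_def)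
    next
      case False
      then show ?thesis unfolding h_def by (simp only: if_False comp_apply)
    qed
  qed
  ultimately have "h \<in> iso (BijGroup X) (sym_group m)"
    using h_perm by (auto simp: iso_def hom_def BijGroup_def sym_group_def)
  moreover have "\<forall>g\<in>carrier (BijGroup X). \<forall>x\<in>X. f (g x) = h g (f x)"
    using ff by (simp add: h_def)
  ultimately show ?thesis
    using f unfolding is_symmetric_perm_group_def perm_isomorphic_def by blast
qed

text \<open>Already the generators exhaust \<open>Bij X\<close>. A bijection of \<open>X\<close>,
  extended by the identity, fixes the two holes chosen in \<open>W\<close> and is realised by
  sliding; precomposing the resulting \<open>s\<close> with the retraction \<open>c\<close> sends
  \<open>W\<close> into \<open>X\<close> without changing the action on \<open>X\<close>.\<close>

lemma defect_group_noncycle: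
  assumes "bridgeless_graph (pverts G) (parcs G)" "\<not> is_cycle_graph G"
    and W: "W \<subset> pverts G" "2 \<le> card W"
  shows "defect_group G W = BijGroup (pverts G - W)"
proof -
  interpret bridgeless_graph "pverts G" "parcs G" by fact
  define X where "X = pverts G - W"
  have "finite W" using W(1) finite_V finite_subset by blast
  obtain H where "H \<subseteq> W" "card H = 2"
    using W(2) by (meson obtain_subset_with_card_n)
  then obtain h h' where H: "H = {h, h'}" "h \<noteq> h'" by (meson card_2_iff)
  have "H \<subseteq> pverts G" using \<open>H \<subseteq> W\<close> W by blast
  have "W \<noteq> {}" using W(2) by auto
  then have "parcs G \<noteq> {}" using cut_edge[OF W(1)] by blast
  then obtain v x y z where star: "(v, x) \<in> parcs G" "(v, y) \<in> parcs G" "(v, z) \<in> parcs G" "distinct [x, y, z]"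
    using is_cycle_graphI[OF assms(1)] assms(2) W(1) by blast
  obtain c where c: "c \<in> flow_semigroup G" "\<And>x. x \<notin> W \<Longrightarrow> c x = x" "c ` W \<subseteq> X"
    using flow_retraction[OF \<open>finite W\<close> W(1) \<open>W \<noteq> {}\<close> cut_edge] unfolding X_def by blast
  let ?gens = "{restrict s X |s. s \<in> flow_semigroup G \<and> s ` X = X \<and> s ` W \<subseteq> X}"
  have "finite X" using finite_V by (simp add: X_def)
  have "?gens = Bij X"
  proof (intro equalityI subsetI)
    fix g assume "g \<in> ?gens"
    then obtain s where s: "g = restrict s X" "s ` X = X" by blast
    then have "bij_betw s X X"
      using \<open>finite X\<close> by (simp add: bij_betw_def finite_surj_inj)
    then have "bij_betw g X X"
      unfolding s(1) by (rule bij_betw_cong[THEN iffD1, rotated]) simp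
    then show "g \<in> Bij X" using s(1) by (simp add: Bij_def)
  next
    fix g assume g: "g \<in> Bij X"
    define f where "f x = (if x \<in> X then g x else x)" for x
    have "bij_betw f X X"
      using g by (intro bij_betw_cong[THEN iffD1, of X g f]) (auto simp: f_def Bij_def)
    then have "f permutes X" by (rule bij_imp_permutes) (simp add: f_def)
    then have "f permutes pverts G - H"
      by (rule permutes_subset) (use \<open>H \<subseteq> W\<close> in \<open>auto simp: X_def\<close>)
    then have "slide (parcs G) H id f"
      using slide_any_permutation[OF H \<open>H \<subseteq> pverts G\<close> star] by blast
    then obtain s where s: "s \<in> insert id (flow_semigroup G)" "\<And>x. x \<notin> H \<Longrightarrow> s x = f x"
      using slide_imp_flow[OF _ sym_E] by blast
    have sX: "s x = g x" if "x \<in> X" for x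
      using that s(2)[of x] \<open>H \<subseteq> W\<close> by (auto simp: f_def X_def)
    have "s \<circ> c \<in> flow_semigroup G"
      using s(1) c(1) flow_semigroup.mult by (metis id_comp insertE)
    moreover have cX: "(s \<circ> c) x = g x" if "x \<in> X" for x
      using that c(2)[of x] sX by (simp add: X_def)
    have "g ` X = X" using g by (simp add: Bij_def bij_betw_def)
    then have "(s \<circ> c) ` X = X" using cX by (metis image_cong)
    moreover have "(s \<circ> c) ` W \<subseteq> X"
      using c(3) sX \<open>g ` X = X\<close> by fastforce
    moreover have "g = restrict (s \<circ> c) X"
      using cX Bij_imp_extensional[OF g] by (intro extensionalityI[of _ X]) simp_all
    ultimately show "g \<in> ?gens" by blast
  qed
  moreover have "generate (BijGroup X) (Bij X) = Bij X"
  proof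
    show "generate (BijGroup X) (Bij X) \<subseteq> Bij X"
      using group.generate_incl[OF group_BijGroup, of "Bij X" X] by (simp add: BijGroup_def)
    show "Bij X \<subseteq> generate (BijGroup X) (Bij X)"
      by (auto intro: generate.incl)
  qed
  ultimately have "defect_group G W = (BijGroup X)\<lparr>carrier := Bij X\<rparr>"
    unfolding defect_group_def X_def[symmetric] Let_def by simp
  then show ?thesis by (simp add: BijGroup_def X_def)
qed

section \<open>The cyclic case\<close>

text \<open>A placement of \<open>m\<close> tokens on a cycle of length \<open>n\<close> that respects the cyclic order is lifted to
  the universal cover: token \<open>i mod m\<close> sits at the vertex \<open>\<phi> i mod n\<close>.\<close>

definition lift :: "int \<Rightarrow> int \<Rightarrow> (int \<Rightarrow> int) \<Rightarrow> bool" where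
  "lift n m \<phi> \<longleftrightarrow> strict_mono \<phi> \<and> (\<forall>i. \<phi> (i + m) = \<phi> i + n)"

lemma lift_less: "lift n m \<phi> \<Longrightarrow> i < j \<Longrightarrow> \<phi> i < \<phi> j"
  unfolding lift_def by (blast dest: strict_monoD)

lemma lift_eq_iff: "lift n m \<phi> \<Longrightarrow> \<phi> i = \<phi> j \<longleftrightarrow> i = j"
  unfolding lift_def by (blast dest: strict_mono_eq)

lemma lift_shift:
  assumes "lift n m \<phi>"
  shows "\<phi> (i + m * q) = \<phi> i + n * q"
proof (induction q rule: int_induct[where k = 0])
  case (step1 q)
  have "\<phi> (i + m * (q + 1)) = \<phi> (i + m * q + m)" by (simp add: algebra_simps)
  also have "\<dots> = \<phi> (i + m * q) + n" using assms by (simp only: lift_def)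
  finally show ?case using step1 by (simp add: algebra_simps)
next
  case (step2 q)
  have "\<phi> (i + m * q) = \<phi> (i + m * (q - 1) + m)" by (simp add: algebra_simps)
  also have "\<dots> = \<phi> (i + m * (q - 1)) + n" using assms by (simp only: lift_def)
  finally show ?case using step2 by (simp add: algebra_simps)
qed simp

lemma mod_eq_imp_add_mult:
  fixes i j m :: int
  assumes "i mod m = j mod m"
  shows "\<exists>q. j = i + m * q"
  using assms by (metis mod_eq_dvd_iff dvdE diff_add_cancel add.commute)

lemma lift_mod_iff:
  assumes "lift n m \<phi>"
  shows "\<phi> i mod n = \<phi> j mod n \<longleftrightarrow> i mod m = j mod m"
proof
  assume "\<phi> i mod n = \<phi> j mod n"
  then obtain q where "\<phi> j = \<phi> i + n * q" using mod_eq_imp_add_mult by blast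
  then have "\<phi> j = \<phi> (i + m * q)" using lift_shift[OF assms] by simp
  then have "j = i + m * q" using lift_eq_iff[OF assms] by blast
  then show "i mod m = j mod m" by simp
next
  assume "i mod m = j mod m"
  then obtain q where "j = i + m * q" using mod_eq_imp_add_mult by blast
  then show "\<phi> i mod n = \<phi> j mod n" using lift_shift[OF assms] by simp
qed

lemma lift_diff_ge:
  assumes "lift n m \<phi>" "i \<le> j"
  shows "j - i \<le> \<phi> j - \<phi> i"
  using assms(2)
proof (induction j rule: int_ge_induct)
  case (step j)
  then show ?case using lift_less[OF assms(1), of j "j + 1"] by simp
qed simp

text \<open>Writing \<open>\<psi>\<close> as \<open>\<phi>\<close> after an index map
  \<open>\<theta>\<close>, strict monotonicity and \<open>\<theta> (i + m) = \<theta> i + m\<close>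
  leave no room for gaps: \<open>m\<close> increments of at least 1 add up to \<open>m\<close>, so
  each is exactly 1.\<close>

lemma lift_unique_up_to_rotation:
  assumes \<phi>: "lift n m \<phi>" and \<psi>: "lift n m \<psi>" and "m > 0" and sub: "range \<psi> \<subseteq> range \<phi>"
  shows "\<exists>r. \<forall>i. \<psi> i = \<phi> (i + r)"
proof -
  have "\<forall>i. \<exists>j. \<psi> i = \<phi> j" using sub by blast
  then obtain \<theta> where \<theta>: "\<And>i. \<psi> i = \<phi> (\<theta> i)" by metis
  have "lift m m \<theta>"
    unfolding lift_def
  proof (intro conjI allI strict_monoI)
    show "\<theta> i < \<theta> j" if "i < j" for i j
      using lift_less[OF \<psi> that] \<phi> unfolding \<theta> lift_def by (simp add: strict_mono_less)
    show "\<theta> (i + m) = \<theta> i + m" for i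
    proof -
      have "\<phi> (\<theta> (i + m)) = \<phi> (\<theta> i + m)"
        using \<phi> \<psi> \<theta>[of i] \<theta>[of "i + m"] unfolding lift_def by metis
      then show ?thesis using lift_eq_iff[OF \<phi>] by blast
    qed
  qed
  then have step: "\<theta> (i + 1) = \<theta> i + 1" for i
  proof -
    have "m - 1 \<le> \<theta> (i + m) - \<theta> (i + 1)"
      using lift_diff_ge[OF \<open>lift m m \<theta>\<close>, of "i + 1" "i + m"] \<open>m > 0\<close> by simp
    moreover have "\<theta> (i + m) = \<theta> i + m" using \<open>lift m m \<theta>\<close> by (simp only: lift_def)
    moreover have "\<theta> i < \<theta> (i + 1)" using lift_less[OF \<open>lift m m \<theta>\<close>] by simp
    ultimately show ?thesis by simp
  qed
  have "\<theta> i = i + \<theta> 0" for i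
  proof (induction i rule: int_induct[where k = 0])
    case (step1 i)
    then show ?case using step[of i] by simp
  next
    case (step2 i)
    then show ?case using step[of "i - 1"] by simp
  qed simp
  then show ?thesis using \<theta> by metis
qed

section \<open>Collapsings seen in the lift\<close>

definition push :: "int \<Rightarrow> int \<Rightarrow> int \<Rightarrow> (int \<Rightarrow> int) \<Rightarrow> int \<Rightarrow> int" where
  "push n a \<epsilon> \<phi> i = (if \<phi> i mod n = a mod n then \<phi> i + \<epsilon> else \<phi> i)"

text \<open>All representatives of the pushed token move at once, so periodicity survives. A unit
  step can break strict monotonicity only by landing on an occupied place, which \<open>free\<close>
  forbids.\<close>

lemma lift_push:
  assumes \<phi>: "lift n m \<phi>" and \<epsilon>: "\<epsilon> = 1 \<or> \<epsilon> = -1"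
    and free: "\<And>i j. \<phi> i mod n = a mod n \<Longrightarrow> \<phi> j mod n \<noteq> (a + \<epsilon>) mod n"
  shows "lift n m (push n a \<epsilon> \<phi>)"
  unfolding lift_def
proof (intro conjI allI strict_monoI)
  fix i
  have "\<phi> (i + m) = \<phi> i + n" using \<phi> by (simp only: lift_def)
  then show "push n a \<epsilon> \<phi> (i + m) = push n a \<epsilon> \<phi> i + n" by (simp add: push_def)
next
  fix i j :: int assume "i < j"
  then have less: "\<phi> i < \<phi> j" by (rule lift_less[OF \<phi>])
  have "\<phi> j \<noteq> \<phi> i + \<epsilon>" if "\<phi> i mod n = a mod n"
    using free[OF that, of j] that by (metis mod_add_left_eq)
  moreover have "\<phi> i \<noteq> \<phi> j + \<epsilon>" if "\<phi> j mod n = a mod n"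
    using free[OF that, of i] that by (metis mod_add_left_eq)
  ultimately show "push n a \<epsilon> \<phi> i < push n a \<epsilon> \<phi> j"
    using less \<epsilon> by (auto simp: push_def)
qed

text \<open>\<open>d\<close> is the covering map from the integer line to the cycle; arcs are the
  images of unit steps.\<close>

locale cycle_cover =
  fixes G :: "'a pair_pre_digraph" and d :: "int \<Rightarrow> 'a" and n m :: int
  assumes m_pos: "0 < m" and m_less: "m < n" and n_ge: "3 \<le> n"
    and d_eq_iff: "d i = d j \<longleftrightarrow> i mod n = j mod n"
    and arc_iff: "(u, v) \<in> parcs G \<longleftrightarrow> (\<exists>a \<epsilon>. (\<epsilon> = 1 \<or> \<epsilon> = -1) \<and> u = d a \<and> v = d (a + \<epsilon>))"
begin

lemma collapsing_push: "collapsing (d a) (d (a + \<epsilon>)) (d (\<phi> i)) = d (push n a \<epsilon> \<phi> i)"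
proof (cases "\<phi> i mod n = a mod n")
  case True
  then have "d (a + \<epsilon>) = d (\<phi> i + \<epsilon>)" "d (\<phi> i) = d a" unfolding d_eq_iff by (metis mod_add_left_eq)+
  then show ?thesis using True by (simp add: collapsing_def push_def)
next
  case False
  then have "d (\<phi> i) \<noteq> d a" by (simp add: d_eq_iff)
  then show ?thesis using False by (simp add: collapsing_def push_def)
qed

text \<open>This is the invariance of the cyclic order. If the whole product keeps tokens apart, so
  does each initial factor; hence no collapsing ever moves a token onto an occupied vertex, and
  \<open>lift_push\<close> applies throughout.\<close>

lemma flow_lift:
  assumes "s \<in> flow_semigroup G" "lift n m \<phi>"
    and "\<And>i j. s (d (\<phi> i)) = s (d (\<phi> j)) \<Longrightarrow> i mod m = j mod m"
  shows "\<exists>\<psi>. lift n m \<psi> \<and> (\<forall>i. s (d (\<phi> i)) = d (\<psi> i))"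
  using assms
proof (induction arbitrary: \<phi>)
  case (gen u v)
  then obtain a \<epsilon> where a: "\<epsilon> = 1 \<or> \<epsilon> = -1" "u = d a" "v = d (a + \<epsilon>)" using arc_iff by blast
  have ne: "(a + \<epsilon>) mod n \<noteq> a mod n"
  proof
    assume "(a + \<epsilon>) mod n = a mod n"
    then have "n dvd \<epsilon>" by (simp add: mod_eq_dvd_iff)
    then show False using a(1) n_ge zdvd_imp_le[of n 1] by auto
  qed
  have "lift n m (push n a \<epsilon> \<phi>)"
  proof (rule lift_push[OF gen.prems(1) a(1)])
    fix i j assume i: "\<phi> i mod n = a mod n"
    show "\<phi> j mod n \<noteq> (a + \<epsilon>) mod n"
    proof
      assume j: "\<phi> j mod n = (a + \<epsilon>) mod n"
      have "push n a \<epsilon> \<phi> i mod n = push n a \<epsilon> \<phi> j mod n"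
        using i j ne by (simp add: push_def) (metis mod_add_left_eq)
      then have "i mod m = j mod m"
        using gen.prems(2)[of i j] unfolding a(2,3) collapsing_push d_eq_iff by blast
      then show False using lift_mod_iff[OF gen.prems(1)] i j ne by metis
    qed
  qed
  then show ?case using collapsing_push a by metis
next
  case (mult s t)
  have "i mod m = j mod m" if "s (d (\<phi> i)) = s (d (\<phi> j))" for i j
    using mult.prems(2)[of i j] that by simp
  then obtain \<psi> where \<psi>: "lift n m \<psi>" "\<And>i. s (d (\<phi> i)) = d (\<psi> i)"
    using mult.IH(1)[OF mult.prems(1)] by blast
  have "i mod m = j mod m" if "t (d (\<psi> i)) = t (d (\<psi> j))" for i j
    using mult.prems(2)[of i j] that \<psi>(2) by simp
  then obtain \<chi> where "lift n m \<chi>" "\<And>i. t (d (\<psi> i)) = d (\<chi> i)"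
    using mult.IH(2)[OF \<psi>(1)] by blast
  then show ?case using \<psi>(2) by (intro exI[of _ \<chi>]) simp
qed

text \<open>If every token short of its target were blocked by its successor, then all tokens would sit on
  consecutive vertices, leaving no free vertex on the cycle.\<close>

lemma flow_advance:
  assumes "lift n m \<psi>" "lift n m \<chi>" "\<And>i. \<psi> i \<le> \<chi> i"
  shows "\<exists>s\<in>insert id (flow_semigroup G). \<forall>i. s (d (\<psi> i)) = d (\<chi> i)"
  using assms
\<comment> \<open>The remaining distance, summed over one period so that each token counts
  once.\<close>
proof (induction "nat (\<Sum>i\<in>{0..<m}. \<chi> i - \<psi> i)" arbitrary: \<psi> rule: less_induct)
  case less
  show ?case
  proof (cases "\<psi> = \<chi>")
    case True
    then show ?thesis by auto
  next
    case False
    then obtain i0 where "\<psi> i0 \<noteq> \<chi> i0" by blast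
    then have i0: "\<psi> i0 < \<chi> i0" using less.prems(3)[of i0] by simp
    have "\<exists>i. \<psi> i < \<chi> i \<and> \<psi> (i + 1) \<noteq> \<psi> i + 1"
    proof (rule ccontr)
      assume no: "\<not> ?thesis"
      \<comment> \<open>Being short of the target passes to the blocking successor, because it sits
        at most at \<open>\<chi>\<close> of its predecessor and \<open>\<chi>\<close> increases
        strictly. After \<open>m\<close> steps the tokens would advance by \<open>m\<close>, but
        periodicity demands \<open>n\<close>.\<close>
      have "\<psi> (i0 + int k) < \<chi> (i0 + int k) \<and> \<psi> (i0 + int k) = \<psi> i0 + int k" for k
      proof (induction k)
        case 0
        then show ?case using i0 by simp
      next
        case (Suc k)
        have eq: "i0 + int (Suc k) = i0 + int k + 1" by simp
        have "\<psi> (i0 + int k + 1) = \<psi> (i0 + int k) + 1" using no Suc by blast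
        moreover have "\<chi> (i0 + int k) < \<chi> (i0 + int k + 1)" using lift_less[OF less.prems(2)] by simp
        ultimately show ?case using Suc unfolding eq by simp
      qed
      from this[of "nat m"] have "\<psi> (i0 + m) = \<psi> i0 + m" using m_pos by simp
      then show False using less.prems(1) m_less by (simp add: lift_def)
    qed
    then obtain i where i: "\<psi> i < \<chi> i" "\<psi> (i + 1) \<noteq> \<psi> i + 1" by blast
    let ?\<psi>' = "push n (\<psi> i) 1 \<psi>"
    have lift': "lift n m ?\<psi>'"
    proof (rule lift_push[OF less.prems(1)])
      fix j
      show "\<psi> j mod n \<noteq> (\<psi> i + 1) mod n"
      proof
        assume "\<psi> j mod n = (\<psi> i + 1) mod n"
        then obtain q where "\<psi> i + 1 = \<psi> j + n * q" using mod_eq_imp_add_mult by blast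
        then have q: "\<psi> i + 1 = \<psi> (j + m * q)" using lift_shift[OF less.prems(1)] by simp
        have "i < j + m * q"
        proof (rule ccontr)
          assume "\<not> i < j + m * q"
          then have "\<psi> (j + m * q) \<le> \<psi> i"
            using lift_less[OF less.prems(1), of "j + m * q" i] by (cases "i = j + m * q") auto
          then show False using q by simp
        qed
        moreover have "\<psi> i < \<psi> (i + 1)" using lift_less[OF less.prems(1)] by simp
        ultimately have "i + 1 < j + m * q" using i(2) q by (cases "i + 1 = j + m * q") auto
        then show False using lift_less[OF less.prems(1)] q \<open>\<psi> i < \<psi> (i + 1)\<close> by fastforce
      qed
    qed simp
    have le: "?\<psi>' j \<le> \<chi> j" for j
    proof (cases "\<psi> j mod n = \<psi> i mod n")
      case True
      then obtain q where "j = i + m * q"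
        using lift_mod_iff[OF less.prems(1)] mod_eq_imp_add_mult by metis
      then have "\<psi> j < \<chi> j" using i(1) lift_shift[OF less.prems(1)] lift_shift[OF less.prems(2)] by simp
      then show ?thesis by (simp add: push_def)
    next
      case False
      then show ?thesis using less.prems(3) by (simp add: push_def)
    qed
    have "(\<Sum>j\<in>{0..<m}. \<chi> j - ?\<psi>' j) < (\<Sum>j\<in>{0..<m}. \<chi> j - \<psi> j)"
    proof (rule sum_strict_mono_ex1)
      have "\<psi> (i mod m) mod n = \<psi> i mod n" using lift_mod_iff[OF less.prems(1)] by simp
      then show "\<exists>j\<in>{0..<m}. \<chi> j - ?\<psi>' j < \<chi> j - \<psi> j"
        using m_pos by (intro bexI[of _ "i mod m"]) (simp_all add: push_def)
    qed (simp_all add: push_def)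
    moreover have "0 \<le> (\<Sum>j\<in>{0..<m}. \<chi> j - ?\<psi>' j)" using le by (intro sum_nonneg) simp
    ultimately have "nat (\<Sum>j\<in>{0..<m}. \<chi> j - ?\<psi>' j) < nat (\<Sum>j\<in>{0..<m}. \<chi> j - \<psi> j)" by simp
    from less.hyps[OF this lift' less.prems(2) le]
    obtain s where s: "s \<in> insert id (flow_semigroup G)" "\<And>j. s (d (?\<psi>' j)) = d (\<chi> j)" by blast
    let ?c = "collapsing (d (\<psi> i)) (d (\<psi> i + 1))"
    have "?c \<in> flow_semigroup G" by (rule flow_semigroup.gen) (use arc_iff in blast)
    then have "s \<circ> ?c \<in> flow_semigroup G"
      using s(1) flow_semigroup.mult by (metis id_comp insertE)
    moreover have "(s \<circ> ?c) (d (\<psi> j)) = d (\<chi> j)" for j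
      using s(2)[of j] collapsing_push[of "\<psi> i" 1 \<psi> j] by simp
    ultimately show ?thesis by blast
  qed
qed

end

text \<open>List the representatives of \<open>X\<close> in \<open>{0..<n}\<close> in increasing
  order and repeat the list with offset \<open>n\<close> in every period.\<close>

lemma ex_lift_enumerating:
  fixes d :: "int \<Rightarrow> 'a" and n :: int
  assumes d: "\<And>i j. d i = d j \<longleftrightarrow> i mod n = j mod n" and "0 < n"
    and X: "X \<subseteq> range d" "X \<noteq> {}"
  shows "\<exists>\<phi>. lift n (int (card X)) \<phi> \<and> range (\<lambda>i. d (\<phi> i)) = X"
proof -
  define P where "P = {i\<in>{0..<n}. d i \<in> X}"
  define L where "L = sorted_list_of_set P"
  have "finite P" unfolding P_def by (rule finite_subset[of _ "{0..<n}"]) auto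
  have L: "sorted_wrt (<) L" "set L = P" "length L = card P"
    using \<open>finite P\<close> by (simp_all add: L_def)
  have "inj_on d P" using d by (auto simp: inj_on_def P_def)
  moreover have "d ` P = X"
  proof (intro equalityI subsetI)
    fix x assume "x \<in> X"
    then obtain i where "x = d i" using X(1) by blast
    then have "x = d (i mod n)" using d[of i "i mod n"] by simp
    moreover from this have "i mod n \<in> P" using \<open>x \<in> X\<close> \<open>0 < n\<close> by (simp add: P_def)
    ultimately show "x \<in> d ` P" by (rule image_eqI)
  next
    fix x assume "x \<in> d ` P"
    then show "x \<in> X" by (auto simp: P_def)
  qed
  ultimately have "card P = card X" using card_image[of d P] by simp
  define m where "m = int (card X)"
  have "finite X" using \<open>d ` P = X\<close> \<open>finite P\<close> by blast
  then have "m > 0" using X(2) by (simp add: m_def card_gt_0_iff)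
  have len: "int (length L) = m" using L(3) \<open>card P = card X\<close> by (simp add: m_def)
  define \<phi> where "\<phi> i = L ! nat (i mod m) + n * (i div m)" for i
  have idx: "nat (i mod m) < length L" for i using len \<open>m > 0\<close> pos_mod_bound[of m i] by linarith
  have L_in: "L ! k \<in> P" if "k < length L" for k using that L(2) nth_mem by metis
  have bounds: "0 \<le> L ! k" "L ! k < n" if "k < length L" for k
    using L_in[OF that] by (auto simp: P_def)
  have "\<phi> (i + m) = \<phi> i + n" for i
    using \<open>m > 0\<close> by (simp add: \<phi>_def algebra_simps)
  moreover have "strict_mono \<phi>"
  proof (rule strict_monoI)
    fix i j :: int assume "i < j"
    show "\<phi> i < \<phi> j"
    proof (cases "i div m = j div m")
      case True
      then have "i mod m < j mod m" using \<open>i < j\<close> by (metis add_less_cancel_left mult_div_mod_eq)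
      then have "nat (i mod m) < nat (j mod m)"
        using pos_mod_sign[OF \<open>m > 0\<close>, of i] by linarith
      then have "L ! nat (i mod m) < L ! nat (j mod m)"
        using sorted_wrt_nth_less[OF L(1)] idx by blast
      then show ?thesis using True by (simp add: \<phi>_def)
    next
      case False
      then have "i div m + 1 \<le> j div m" using zdiv_mono1[of i j m] \<open>i < j\<close> \<open>m > 0\<close> by simp
      then have "n * (i div m + 1) \<le> n * (j div m)" using \<open>0 < n\<close> by (intro mult_left_mono) simp_all
      then show ?thesis using bounds(2)[OF idx[of i]] bounds(1)[OF idx[of j]] by (simp add: \<phi>_def algebra_simps)
    qed
  qed
  moreover have "range (\<lambda>i. d (\<phi> i)) = X"
  proof (intro equalityI subsetI)
    fix x assume "x \<in> range (\<lambda>i. d (\<phi> i))"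
    then obtain i where "x = d (\<phi> i)" by blast
    then have "x = d (L ! nat (i mod m))" using d by (simp add: \<phi>_def)
    then show "x \<in> X" using L_in[OF idx[of i]] by (simp add: P_def)
  next
    fix x assume "x \<in> X"
    then obtain k where k: "k < length L" "x = d (L ! k)"
      using \<open>d ` P = X\<close> L(2) by (metis imageE in_set_conv_nth)
    then have "\<phi> (int k) = L ! k" using len by (simp add: \<phi>_def)
    then show "x \<in> range (\<lambda>i. d (\<phi> i))" using k(2) by (metis rangeI)
  qed
  ultimately show ?thesis unfolding lift_def m_def by blast
qed

text \<open>Since the generators are rotations and include the one by a single place, they generate
  exactly the rotations. Naming each point by its index modulo \<open>m\<close> turns these into
  translations.\<close>

lemma is_cyclic_perm_group_rotations:
  fixes e :: "int \<Rightarrow> 'a"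
  assumes e: "\<And>i j. e i = e j \<longleftrightarrow> i mod int m = j mod int m" "range e = X" and "0 < m"
    and gens: "\<And>g. g \<in> gens \<Longrightarrow> g \<in> extensional X \<and> (\<exists>r. \<forall>i. g (e i) = e (i + r))"
    and rot1: "g1 \<in> gens" "\<And>i. g1 (e i) = e (i + 1)"
  shows "is_cyclic_perm_group ((BijGroup X)\<lparr>carrier := generate (BijGroup X) gens\<rparr>) X m"
proof -
  define f where "f x = (SOME i. e i = x) mod int m" for x
  have fe: "f (e i) = i mod int m" for i
  proof -
    have "e (SOME j. e j = e i) = e i" by (rule someI) (rule HOL.refl)
    then show ?thesis using e(1) by (simp add: f_def)
  qed
  have ef: "e (f x) = x" if "x \<in> X" for x
  proof -
    obtain i where "x = e i" using \<open>x \<in> X\<close> e(2) by blast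
    then show ?thesis using fe[of i] e(1) by simp
  qed
  have eX: "e i \<in> X" for i using e(2) by blast
  have f_range: "f x \<in> {0..<int m}" for x using \<open>0 < m\<close> by (simp add: f_def)
  define rot where "rot r = (\<lambda>x\<in>X. e (f x + r))" for r
  have rot_e: "rot r (e i) = e (i + r)" for r i
    using eX e(1) by (simp add: rot_def fe mod_add_left_eq)
  have rot_eqI: "g = rot r" if "g \<in> extensional X" "\<And>i. g (e i) = e (i + r)" for g r
  proof (rule extensionalityI[OF that(1), of "rot r"])
    show "rot r \<in> extensional X" by (simp add: rot_def)
    show "g x = rot r x" if "x \<in> X" for x
      using that \<open>\<And>i. g (e i) = e (i + r)\<close> rot_e e(2) by (metis rangeE)
  qed
  have rot_Bij: "rot r \<in> Bij X" for r
  proof -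
    have "bij_betw (rot r) X X"
    proof (rule bij_betw_byWitness[where f' = "rot (- r)"])
      show "\<forall>x\<in>X. rot (- r) (rot r x) = x" "\<forall>x\<in>X. rot r (rot (- r) x) = x"
        using e(2) rot_e by auto
      show "rot r ` X \<subseteq> X" "rot (- r) ` X \<subseteq> X" using e(2) rot_e eX by auto
    qed
    then show ?thesis by (simp add: Bij_def rot_def)
  qed
  have rot_mult: "rot r \<otimes>\<^bsub>BijGroup X\<^esub> rot r' = rot (r + r')" for r r'
  proof (rule rot_eqI)
    have eq: "rot r \<otimes>\<^bsub>BijGroup X\<^esub> rot r' = compose X (rot r) (rot r')"
      using rot_Bij by (simp add: BijGroup_def)
    show "rot r \<otimes>\<^bsub>BijGroup X\<^esub> rot r' \<in> extensional X" unfolding eq by simp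
    show "(rot r \<otimes>\<^bsub>BijGroup X\<^esub> rot r') (e i) = e (i + (r + r'))" for i
      unfolding eq using eX by (simp add: compose_def rot_e algebra_simps)
  qed
  have rot_one: "\<one>\<^bsub>BijGroup X\<^esub> = rot 0"
    using eX by (intro rot_eqI) (simp_all add: BijGroup_def)
  have rot_inv: "inv\<^bsub>BijGroup X\<^esub> (rot r) = rot (- r)" for r
  proof (rule group.inv_equality[OF group_BijGroup])
    show "rot (- r) \<otimes>\<^bsub>BijGroup X\<^esub> rot r = \<one>\<^bsub>BijGroup X\<^esub>" by (simp add: rot_mult rot_one)
  qed (use rot_Bij in \<open>simp_all add: BijGroup_def\<close>)
  have gens_rot: "\<exists>r. g = rot r" if "g \<in> gens" for g
    using gens[OF that] rot_eqI by blast
  have "g1 = rot 1" using gens[OF rot1(1)] rot1(2) rot_eqI by blast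
  have rot_nat: "rot (int k) \<in> generate (BijGroup X) gens" for k
  proof (induction k)
    case 0
    show ?case using generate.one[of "BijGroup X" gens] by (simp add: rot_one)
  next
    case (Suc k)
    have "rot 1 \<otimes>\<^bsub>BijGroup X\<^esub> rot (int k) \<in> generate (BijGroup X) gens"
      using generate.incl[OF rot1(1)] Suc unfolding \<open>g1 = rot 1\<close> by (rule generate.eng)
    then show ?case by (simp add: rot_mult)
  qed
  have rot_mod: "rot r = rot (r mod int m)" for r
  proof (rule rot_eqI)
    show "rot r (e i) = e (i + r mod int m)" for i
      unfolding rot_e e(1) by (simp add: mod_add_right_eq)
  qed (simp add: rot_def)
  have carrier: "generate (BijGroup X) gens = range rot"
  proof (intro equalityI subsetI)
    fix g assume "g \<in> generate (BijGroup X) gens"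
    then show "g \<in> range rot"
    proof induction
      case one
      show ?case by (simp add: rot_one)
    next
      case (incl g)
      then show ?case using gens_rot by blast
    next
      case (inv g)
      then show ?case using gens_rot rot_inv by blast
    next
      case (eng g g')
      then show ?case using rot_mult by auto
    qed
  next
    fix g assume "g \<in> range rot"
    then obtain r where "g = rot (r mod int m)" using rot_mod by blast
    then show "g \<in> generate (BijGroup X) gens"
      using rot_nat[of "nat (r mod int m)"] \<open>0 < m\<close> by simp
  qed
  \<comment> \<open>A rotation is determined by the image of \<open>e 0\<close>, whose index is the
    amount of rotation.\<close>
  define h where "h g = f (g (e 0))" for g
  have h_rot: "h (rot r) = r mod int m" for r by (simp add: h_def rot_e fe)
  have bij_h: "bij_betw h (range rot) {0..<int m}"
  proof (rule bij_betw_byWitness[where f' = rot])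
    show "\<forall>g\<in>range rot. rot (h g) = g" using h_rot rot_mod by (metis imageE)
    show "\<forall>r\<in>{0..<int m}. h (rot r) = r" by (simp add: h_rot)
    show "h ` range rot \<subseteq> {0..<int m}" using f_range by (auto simp: h_def)
    show "rot ` {0..<int m} \<subseteq> range rot" by blast
  qed
  let ?A = "(BijGroup X)\<lparr>carrier := generate (BijGroup X) gens\<rparr>"
  have "h \<in> iso ?A (integer_mod_group m)"
  proof (rule isoI)
    show "h \<in> hom ?A (integer_mod_group m)"
    proof (rule homI)
      fix g assume "g \<in> carrier ?A"
      then show "h g \<in> carrier (integer_mod_group m)"
        using f_range \<open>0 < m\<close> by (simp add: h_def carrier_integer_mod_group)
    next
      fix g g' assume "g \<in> carrier ?A" "g' \<in> carrier ?A"
      then obtain r r' where r: "g = rot r" "g' = rot r'" unfolding carrier by auto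
      show "h (g \<otimes>\<^bsub>?A\<^esub> g') = h g \<otimes>\<^bsub>integer_mod_group m\<^esub> h g'"
        by (simp add: r rot_mult h_rot mod_add_eq)
    qed
    show "bij_betw h (carrier ?A) (carrier (integer_mod_group m))"
      using bij_h \<open>0 < m\<close> by (simp add: carrier carrier_integer_mod_group)
  qed
  moreover have "bij_betw f X (carrier (integer_mod_group m))"
  proof (rule bij_betw_byWitness[where f' = e])
    show "\<forall>x\<in>X. e (f x) = x" using ef by blast
    show "\<forall>i\<in>carrier (integer_mod_group m). f (e i) = i" using \<open>0 < m\<close> by (simp add: carrier_integer_mod_group fe)
    show "f ` X \<subseteq> carrier (integer_mod_group m)" using f_range \<open>0 < m\<close> by (auto simp: carrier_integer_mod_group)
    show "e ` carrier (integer_mod_group m) \<subseteq> X" using eX by blast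
  qed
  moreover have "f (g x) = h g \<otimes>\<^bsub>integer_mod_group m\<^esub> f x" if "g \<in> carrier ?A" "x \<in> X" for g x
  proof -
    obtain r where r: "g = rot r" using \<open>g \<in> carrier ?A\<close> unfolding carrier by auto
    obtain i where "x = e i" using \<open>x \<in> X\<close> e(2) by blast
    then show ?thesis by (simp add: r rot_e h_rot fe mod_add_eq add.commute)
  qed
  ultimately show ?thesis
    unfolding is_cyclic_perm_group_def perm_isomorphic_def by blast
qed

text \<open>\<open>flow_lift\<close> with \<open>lift_unique_up_to_rotation\<close> shows that every
  generator is a rotation; \<open>flow_advance\<close> realises the rotation by one place, with the
  free vertex supplied by \<open>W\<close>.\<close>

lemma cyclic_defect_group:
  assumes "bridgeless_graph (pverts G) (parcs G)" "is_cycle_graph G"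
    and W: "W \<subset> pverts G" "W \<noteq> {}"
  shows "is_cyclic_perm_group (defect_group G W) (pverts G - W) (card (pverts G) - card W)"
proof -
  interpret bridgeless_graph "pverts G" "parcs G" by fact
  define X where "X = pverts G - W"
  have "finite W" using W(1) finite_V finite_subset by blast
  have cardX: "card X = card (pverts G) - card W"
    unfolding X_def using W(1) \<open>finite W\<close> by (intro card_Diff_subset) auto
  have "finite X" "X \<noteq> {}" using W finite_V by (auto simp: X_def)
  obtain n c where c: "3 \<le> n" "bij_betw c {..<n} (pverts G)"
    "parcs G = (\<Union>i<n. {(c i, c (Suc i mod n)), (c (Suc i mod n), c i)})"
    using assms(2) unfolding is_cycle_graph_def by blast
  \<comment> \<open>Periodic extension of the vertex numbering to the integers, so that the closing
    edge of the cycle is no longer special.\<close>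
  define d where "d i = c (nat (i mod int n))" for i
  have idx: "nat (i mod int n) < n" for i
    using c(1) pos_mod_bound[of "int n" i] by linarith
  have d_eq: "d i = d j \<longleftrightarrow> i mod int n = j mod int n" for i j
  proof -
    have "d i = d j \<longleftrightarrow> nat (i mod int n) = nat (j mod int n)"
      unfolding d_def using bij_betw_imp_inj_on[OF c(2)] idx by (auto simp: inj_on_eq_iff)
    then show ?thesis using c(1) by (auto simp: nat_eq_iff2)
  qed
  have d_int: "d (int i) = c i" if "i < n" for i using that by (simp add: d_def)
  have d_Suc: "c (Suc i mod n) = d (int i + 1)" if "i < n" for i
  proof -
    have "int (Suc i mod n) = (int i + 1) mod int n" by (simp add: zmod_int add.commute)
    then show ?thesis unfolding d_def by (metis nat_int)
  qed
  have range_d: "range d = pverts G"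
  proof (intro equalityI subsetI)
    fix x assume "x \<in> pverts G"
    then obtain i where "i < n" "x = c i" using c(2) by (auto simp: bij_betw_def)
    then show "x \<in> range d" using d_int by (metis rangeI)
  qed (use bij_betwE[OF c(2)] idx in \<open>auto simp: d_def\<close>)
  have arcs: "(u, v) \<in> parcs G \<longleftrightarrow> (\<exists>a \<epsilon>. (\<epsilon> = 1 \<or> \<epsilon> = -1) \<and> u = d a \<and> v = d (a + \<epsilon>))" for u v
  proof
    assume "(u, v) \<in> parcs G"
    then obtain i where i: "i < n" "(u, v) = (c i, c (Suc i mod n)) \<or> (u, v) = (c (Suc i mod n), c i)"
      using c(3) by blast
    then have "u = d (int i) \<and> v = d (int i + 1) \<or> u = d (int i + 1) \<and> v = d (int i + 1 + -1)"
      using d_int d_Suc by auto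
    then show "\<exists>a \<epsilon>. (\<epsilon> = 1 \<or> \<epsilon> = -1) \<and> u = d a \<and> v = d (a + \<epsilon>)" by blast
  next
    have fwd: "(d a, d (a + 1)) \<in> parcs G" for a
    proof -
      let ?i = "nat (a mod int n)"
      have "d a = c ?i" by (simp add: d_def)
      moreover have "c (Suc ?i mod n) = d (a + 1)"
        unfolding d_Suc[OF idx] d_eq using c(1) by (simp add: mod_add_left_eq)
      ultimately show ?thesis using c(3) idx[of a] by auto
    qed
    assume "\<exists>a \<epsilon>. (\<epsilon> = 1 \<or> \<epsilon> = -1) \<and> u = d a \<and> v = d (a + \<epsilon>)"
    then show "(u, v) \<in> parcs G" using fwd E_sym[OF fwd[of "_ - 1"]] by auto
  qed
  define m where "m = card X"
  have "0 < m" using \<open>finite X\<close> \<open>X \<noteq> {}\<close> by (simp add: m_def card_gt_0_iff)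
  have "card (pverts G) = n" using bij_betw_same_card[OF c(2)] by simp
  moreover have "X \<subset> pverts G" using W by (auto simp: X_def)
  ultimately have "m < n" using psubset_card_mono[OF finite_V] by (auto simp: m_def)
  interpret cycle_cover G d "int n" "int m"
    using \<open>0 < m\<close> \<open>m < n\<close> c(1) d_eq arcs by unfold_locales auto
  obtain \<phi> where \<phi>: "lift (int n) (int m) \<phi>" "range (\<lambda>i. d (\<phi> i)) = X"
    using ex_lift_enumerating[of d "int n" X] d_eq c(1) \<open>X \<noteq> {}\<close> range_d unfolding m_def X_def by auto
  define e where "e i = d (\<phi> i)" for i
  have e: "e i = e j \<longleftrightarrow> i mod int m = j mod int m" for i j
    unfolding e_def d_eq by (rule lift_mod_iff[OF \<phi>(1)])
  have range_e: "range e = X" using \<phi>(2) by (simp add: e_def)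
  let ?gens = "{restrict s X |s. s \<in> flow_semigroup G \<and> s ` X = X \<and> s ` W \<subseteq> X}"
  obtain c where c: "c \<in> flow_semigroup G" "\<And>x. x \<notin> W \<Longrightarrow> c x = x" "c ` W \<subseteq> X"
    using flow_retraction[OF \<open>finite W\<close> W cut_edge] unfolding X_def by blast
  have eX: "e i \<in> X" for i using range_e by blast
  \<comment> \<open>The target of the advance: every token moves to the place of its
    successor.\<close>
  have "lift (int n) (int m) (\<lambda>i. \<phi> (i + 1))"
    unfolding lift_def
  proof (intro conjI allI strict_monoI)
    show "\<phi> (i + 1) < \<phi> (j + 1)" if "i < j" for i j using lift_less[OF \<phi>(1)] that by simp
    show "\<phi> (i + int m + 1) = \<phi> (i + 1) + int n" for i
      using \<phi>(1) unfolding lift_def by (metis add.assoc add.commute)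
  qed
  moreover have "\<phi> i \<le> \<phi> (i + 1)" for i using lift_less[OF \<phi>(1), of i "i + 1"] by simp
  ultimately obtain s where s: "s \<in> insert id (flow_semigroup G)" "\<And>i. s (e i) = e (i + 1)"
    using flow_advance[OF \<phi>(1)] unfolding e_def by blast
  have sc: "(s \<circ> c) (e i) = e (i + 1)" for i
    using c(2)[of "e i"] eX[of i] s(2) by (simp add: X_def)
  have sX: "s ` X = X"
  proof (intro equalityI subsetI)
    fix x assume "x \<in> s ` X"
    then obtain i where "x = s (e i)" using range_e by blast
    then show "x \<in> X" using s(2) eX by simp
  next
    fix x assume "x \<in> X"
    then obtain i where "x = e i" using range_e by blast
    then have "x = s (e (i - 1))" using s(2) by simp
    then show "x \<in> s ` X" using eX by blast
  qed
  have cX: "c ` X = X" using c(2) by (simp add: X_def)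
  have "s \<circ> c \<in> flow_semigroup G"
    using s(1) c(1) flow_semigroup.mult by (metis id_comp insertE)
  moreover have "(s \<circ> c) ` X = X" "(s \<circ> c) ` W \<subseteq> X"
    using sX cX c(3) by (simp_all only: image_comp[symmetric]) blast
  ultimately have g1: "restrict (s \<circ> c) X \<in> ?gens" by blast
  have "is_cyclic_perm_group ((BijGroup X)\<lparr>carrier := generate (BijGroup X) ?gens\<rparr>) X m"
  proof (rule is_cyclic_perm_group_rotations[OF e range_e \<open>0 < m\<close> _ g1])
    show "restrict (s \<circ> c) X (e i) = e (i + 1)" for i using sc eX by simp
  next
    fix g assume "g \<in> ?gens"
    then obtain t where t: "g = restrict t X" "t \<in> flow_semigroup G" "t ` X = X" by blast
    have "inj_on t X" using t(3) \<open>finite X\<close> by (simp add: finite_surj_inj)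
    then have "i mod int m = j mod int m" if "t (d (\<phi> i)) = t (d (\<phi> j))" for i j
      using that eX[of i] eX[of j] e[of i j] unfolding e_def by (auto dest: inj_onD)
    then obtain \<psi> where \<psi>: "lift (int n) (int m) \<psi>" "\<And>i. t (d (\<phi> i)) = d (\<psi> i)"
      using flow_lift[OF t(2) \<phi>(1)] by blast
    \<comment> \<open>By periodicity \<open>range \<phi>\<close> is the full preimage of
      \<open>X\<close> under \<open>d\<close>, and \<open>t\<close> maps \<open>X\<close> to
      itself.\<close>
    have "\<psi> i \<in> range \<phi>" for i
    proof -
      have "d (\<psi> i) \<in> X" using eX[of i] t(3) \<psi>(2)[of i] unfolding e_def by (metis imageI)
      then obtain j where "d (\<phi> j) = d (\<psi> i)" using \<phi>(2) by (metis imageE)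
      then obtain q where "\<psi> i = \<phi> j + int n * q" using d_eq mod_eq_imp_add_mult by metis
      then show ?thesis using lift_shift[OF \<phi>(1), of j q] by (metis rangeI)
    qed
    then obtain r where "\<And>i. \<psi> i = \<phi> (i + r)"
      using lift_unique_up_to_rotation[OF \<phi>(1) \<psi>(1)] \<open>0 < m\<close> by auto
    then have "g (e i) = e (i + r)" for i
      using \<psi>(2)[of i] eX[of i] by (simp add: t(1) e_def)
    then show "g \<in> extensional X \<and> (\<exists>r. \<forall>i. g (e i) = e (i + r))"
      using t(1) by auto
  qed
  then show ?thesis
    unfolding defect_group_def Let_def X_def[symmetric] cardX[symmetric] m_def .
qed

theorem theorem5p10:
  fixes G :: "'a pair_pre_digraph" and W :: "'a set" and n k :: nat
  assumes "pair_graph G"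
    and "card (pverts G) = n"
    and "2 \<le> k" and "k < n"
    and "two_edge_connected G"
    and "W \<subseteq> pverts G" and "card W = k"
  shows "(is_cycle_graph G \<longrightarrow>
            is_cyclic_perm_group (defect_group G W) (pverts G - W) (n - k)) \<and>
         (\<not> is_cycle_graph G \<longrightarrow>
            is_symmetric_perm_group (defect_group G W) (pverts G - W) (n - k))"
proof (intro conjI impI)
  have bridgeless: "bridgeless_graph (pverts G) (parcs G)"
    using assms(1,5) by (rule bridgeless_graph_pair_graph)
  have W: "W \<subset> pverts G" "W \<noteq> {}" "2 \<le> card W" using assms by auto
  show "is_cyclic_perm_group (defect_group G W) (pverts G - W) (n - k)" if "is_cycle_graph G"
    using cyclic_defect_group[OF bridgeless that W(1,2)] assms(2,7) by simp
  have "finite (pverts G)" using bridgeless by (rule bridgeless_graph.finite_V)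
  then have "finite W" using W(1) finite_subset by blast
  then have "card (pverts G - W) = n - k" using assms(2,6,7) by (simp add: card_Diff_subset)
  then show "is_symmetric_perm_group (defect_group G W) (pverts G - W) (n - k)" if "\<not> is_cycle_graph G"
    unfolding defect_group_noncycle[OF bridgeless that W(1,3)]
    using \<open>finite (pverts G)\<close> by (intro is_symmetric_perm_group_BijGroup) simp_all
qed

end
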